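(* Let $X=\{x_i:i\ge1\}$, let $\Lambda_{\mathbb Z}$ be the ring of symmetric functions in $x_1,x_2,\dots$ over $\mathbb Z$, and let $p_n(X)=\sum_i x_i^n$. Let $q$ be an indeterminate. Define symmetric functions $\mathsf u^q_n(X),\mathsf v^q_n(X)$ ($n\ge1$), with coefficients in $\mathbb Q(q)$, by $$\sum_{d|n}d\Big[\tfrac nd\Big]_q\mathsf u^q_d(X)^{n/d}=p_n(X),\qquad \sum_{d|n}d\big(1-q^{n/d}\big)\mathsf v^q_d(X)^{n/d}=p_n(X)\qquad(n\ge1),$$ and define $\mathsf h^q_n(X),\mathsf g^q_n(X)$ by $$1+\sum_{n\ge1}\mathsf h^q_n(X)t^n=\prod_{n\ge1}\frac1{1-\mathsf u^q_n(X)t^n},\qquad 1+\sum_{n\ge1}\mathsf g^q_n(X)t^n=\prod_{n\ge1}\frac1{1-\mathsf v^q_n(X)t^n}.$$ For a partition $\lambda=(\lambda_1,\dots,\lambda_l)$ put $\mathsf u^q_\lambda=\mathsf u^q_{\lambda_1}\cdots\mathsf u^q_{\lambda_l}$ and similarly $\mathsf v^q_\lambda,\mathsf h^q_\lambda,\mathsf g^q_\lambda$. Let $\mathbb Z[q]_{1-q}=\mathbb Z[q][\frac1{1-q}]$ and let $Par$ be the set of all partitions. Then: (a) $\{\mathsf u^q_\lambda(X):\lambda\in Par\}$ is a $\mathbb Q[q]$-basis of $\mathbb Q[q]\otimes\Lambda_{\mathbb Z}$; (b) $\{\mathsf h^q_\lambda(X):\lambda\in Par\}$ is a $\mathbb Q[q]$-basis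 of $\mathbb Q[q]\otimes\Lambda_{\mathbb Z}$; (c) $\{\mathsf v^q_\lambda(X):\lambda\in Par\}$ is a $\mathbb Z[q]_{1-q}$-basis of $\mathbb Z[q]_{1-q}\otimes\Lambda_{\mathbb Z}$; (d) $\{\mathsf g^q_\lambda(X):\lambda\in Par\}$ is a $\mathbb Z[q]_{1-q}$-basis of $\mathbb Z[q]_{1-q}\otimes\Lambda_{\mathbb Z}$.
   Context: $[n]_q=1+q+\dots+q^{n-1}$ for $n\ge1$. *)

theory Defs
  imports "HOL-Computational_Algebra.Polynomial" "HOL-Computational_Algebra.Fraction_Field"
          "HOL-Library.Multiset"
begin

type_synonym ratfun = "rat poly fract"

definition qvar :: ratfun where "qvar = Fract [:0, 1:] 1"

definition qint :: "nat \<Rightarrow> ratfun" where "qint n = (\<Sum>i<n. qvar ^ i)"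

definition Qq :: "ratfun set" where "Qq = {Fract p 1 | p. True}"

definition Zq_loc :: "ratfun set" where
  "Zq_loc = {Fract (map_poly of_int P) 1 / (1 - qvar) ^ k | (P :: int poly) k. True}"

text \<open>Formal power series in the variables x_0, x_1, x_2, ... : a monomial is an exponent
  function nat => nat (of finite support), a series assigns a coefficient to each monomial.\<close>
type_synonym 'a sf = "(nat \<Rightarrow> nat) \<Rightarrow> 'a"

definition sf_mult :: "'a::comm_ring_1 sf \<Rightarrow> 'a sf \<Rightarrow> 'a sf" where
  "sf_mult f g = (\<lambda>m. \<Sum>(a, b) \<in> {(a, b). \<forall>i. a i + b i = m i}. f a * g b)"

definition sf_one :: "'a::comm_ring_1 sf" where
  "sf_one = (\<lambda>m. if m = (\<lambda>_. 0) then 1 else 0)"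

definition sf_pow :: "'a::comm_ring_1 sf \<Rightarrow> nat \<Rightarrow> 'a sf" where
  "sf_pow f n = (sf_mult f ^^ n) sf_one"

definition sf_smult :: "'a::comm_ring_1 \<Rightarrow> 'a sf \<Rightarrow> 'a sf" where
  "sf_smult c f = (\<lambda>m. c * f m)"

definition sf_sum :: "('i \<Rightarrow> 'a::comm_ring_1 sf) \<Rightarrow> 'i set \<Rightarrow> 'a sf" where
  "sf_sum F I = (\<lambda>m. \<Sum>i\<in>I. F i m)"

definition psum :: "nat \<Rightarrow> 'a::comm_ring_1 sf" where
  "psum n = (\<lambda>m. if \<exists>i. m = (\<lambda>j. if j = i then n else 0) then 1 else 0)"

definition mdeg :: "(nat \<Rightarrow> nat) \<Rightarrow> nat" where
  "mdeg m = (\<Sum>i\<in>{i. m i \<noteq> 0}. m i)"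

text \<open>Symmetric functions with coefficients in a subring R: series supported on
  finite-support monomials, of bounded degree, invariant under all permutations of the
  variables, with all coefficients in R.  For R = Q[q] or Z[q][1/(1-q)] this is
  R \<otimes> Lambda_Z (Lambda_Z is free on the monomial symmetric functions).\<close>
definition is_symfun :: "'a::comm_ring_1 set \<Rightarrow> 'a sf \<Rightarrow> bool" where
  "is_symfun R f \<longleftrightarrow>
     (\<forall>m. f m \<noteq> 0 \<longrightarrow> finite {i. m i \<noteq> 0}) \<and>
     (\<exists>d. \<forall>m. f m \<noteq> 0 \<longrightarrow> mdeg m \<le> d) \<and>
     (\<forall>\<sigma> m. bij \<sigma> \<longrightarrow> f (m \<circ> \<sigma>) = f m) \<and>
     (\<forall>m. f m \<in> R)"

definition Par :: "nat multiset set" where "Par = {lam. 0 \<notin># lam}"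

definition sf_part :: "(nat \<Rightarrow> 'a::comm_ring_1 sf) \<Rightarrow> nat multiset \<Rightarrow> 'a sf" where
  "sf_part b lam = foldr (\<lambda>k acc. sf_mult (b k) acc) (sorted_list_of_multiset lam) sf_one"

definition sf_lincomb :: "(nat multiset \<Rightarrow> 'a::comm_ring_1) \<Rightarrow> (nat multiset \<Rightarrow> 'a sf) \<Rightarrow> 'a sf" where
  "sf_lincomb c B = sf_sum (\<lambda>lam. sf_smult (c lam) (B lam)) {lam. c lam \<noteq> 0}"

definition is_sf_basis :: "'a::comm_ring_1 set \<Rightarrow> (nat multiset \<Rightarrow> 'a sf) \<Rightarrow> bool" where
  "is_sf_basis R B \<longleftrightarrow>
     (\<forall>lam\<in>Par. is_symfun R (B lam)) \<and>
     (\<forall>f. is_symfun R f \<longrightarrow>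
        (\<exists>!c. (\<forall>lam. c lam \<in> R) \<and> finite {lam. c lam \<noteq> 0} \<and> {lam. c lam \<noteq> 0} \<subseteq> Par
              \<and> f = sf_lincomb c B))"

end

theory Submission
  imports Defs "HOL-Combinatorics.Permutations" "HOL-Computational_Algebra.Formal_Power_Series"
begin

text \<open>
  Each family is compared with the elementary symmetric functions through changes of generators
  that are triangular with unit diagonal.  Newton's identities and the definition of \<open>u\<^sub>n\<close> have
  diagonal \<open>n\<close>, a unit of \<open>\<rat>[q]\<close>.  For \<open>v\<^sub>n\<close>, the definition says that
  \<open>\<Prod>\<^sub>d (1 - q v\<^sub>d t\<^sup>d) / (1 - v\<^sub>d t\<^sup>d)\<close> has the logarithmic derivative of the generating function of
  the complete symmetric functions; so the two series agree, and comparing coefficients of \<open>t\<^sup>n\<close>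
  gives \<open>(1 - q) v\<^sub>n\<close> plus an integral polynomial in the earlier \<open>v\<^sub>d\<close>, which needs no division by
  integers.  The passages \<open>u \<rightarrow> h\<close> and \<open>v \<rightarrow> g\<close> are unitriangular.  Hence all four families span;
  they are independent because the monomial symmetric functions of degree \<open>n\<close> are independent and
  as numerous as the partitions of \<open>n\<close>.
\<close>

section \<open>The ring of power series in infinitely many variables\<close>

text \<open>The obstacle is the ring \<open>Zq_loc\<close>: the equations for \<open>v\<close> put
  \<open>n * (1 - q)\<close> in front of \<open>v n\<close>, and \<open>n\<close> is not invertible
  there for n > 1. Division by \<open>n\<close> is still legitimate in the ambient field of
  characteristic zero when it only shows that two series are equal; membership over
  \<open>Zq_loc\<close> is then read off from the product formula, whose only denominator is
  \<open>1 - q\<close>. Each family needs two inclusions: its generators must be symmetric with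
  coefficients in \<open>R\<close>, and the elementary symmetric functions must be polynomials in
  them over \<open>R\<close>. Both are closure statements about a graded algebra, so most recursions
  are proved for an abstract one and instantiated with \<open>sym_hom R\<close> and with
  \<open>part_span R b\<close>. Uniqueness of coefficients is settled over the whole field, where a
  dimension count is available; coefficients in \<open>R\<close> are a special case.\<close>

text \<open>A monomial is the multiset of its variable indices; this excludes the monomials of infinite
  support, on which elements of type \<^typ>\<open>'a sf\<close> may take junk values.\<close>

typedef 'a series = "UNIV :: (nat multiset \<Rightarrow> 'a) set"
  morphisms cf Series by simp

setup_lifting type_definition_series

lemma cf_Series [simp]: "cf (Series f) = f"
  by (simp add: Series_inverse)

lemma series_eqI: "(\<And>M. cf F M = cf G M) \<Longrightarrow> F = G"
  by (metis cf_inject ext)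

definition splits :: "nat multiset \<Rightarrow> (nat multiset \<times> nat multiset) set" where
  "splits M = {(A, B). A + B = M}"

lemma finite_submultisets: "finite {A. A \<subseteq># M}"
proof (induction M)
  case (add x M)
  have "{A. A \<subseteq># add_mset x M} \<subseteq> {A. A \<subseteq># M} \<union> add_mset x ` {A. A \<subseteq># M}"
  proof
    fix A assume A: "A \<in> {A. A \<subseteq># add_mset x M}"
    show "A \<in> {A. A \<subseteq># M} \<union> add_mset x ` {A. A \<subseteq># M}"
    proof (cases "x \<in># A")
      case True
      then obtain A' where "A = add_mset x A'" by (metis insert_DiffM)
      with A show ?thesis by auto
    next
      case False
      have "A \<subseteq># M"
      proof (rule mset_subset_eqI)
        fix a show "count A a \<le> count M a"
          using A False mset_subset_eq_count[of A "add_mset x M" a]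
          by (cases "a = x") (auto simp: not_in_iff)
      qed
      then show ?thesis by simp
    qed
  qed
  then show ?case using add finite_subset by blast
qed simp

lemma splits_eq: "splits M = (\<lambda>A. (A, M - A)) ` {A. A \<subseteq># M}"
  by (auto simp: splits_def image_iff)

lemma finite_splits [simp]: "finite (splits M)"
  by (simp add: splits_eq finite_submultisets)

instantiation series :: (comm_ring_1) comm_ring_1
begin

lift_definition zero_series :: "'a series" is "\<lambda>_. 0" .
lift_definition one_series :: "'a series" is "\<lambda>M. if M = {#} then 1 else 0" .
lift_definition plus_series :: "'a series \<Rightarrow> 'a series \<Rightarrow> 'a series" is "\<lambda>f g M. f M + g M" .
lift_definition minus_series :: "'a series \<Rightarrow> 'a series \<Rightarrow> 'a series" is "\<lambda>f g M. f M - g M" .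
lift_definition uminus_series :: "'a series \<Rightarrow> 'a series" is "\<lambda>f M. - f M" .
lift_definition times_series :: "'a series \<Rightarrow> 'a series \<Rightarrow> 'a series"
  is "\<lambda>f g M. \<Sum>(A, B)\<in>splits M. f A * g B" .

instance
proof
  fix F G H :: "'a series"
  show "F + G + H = F + (G + H)" "F + G = G + F" "0 + F = F" "- F + F = 0" "F - G = F + - G"
    by (transfer; simp add: algebra_simps fun_eq_iff)+
  show "(0 :: 'a series) \<noteq> 1"
    by transfer (auto simp: fun_eq_iff)
  show "(F + G) * H = F * H + G * H"
    by transfer (auto simp: fun_eq_iff algebra_simps sum.distrib split_beta)
  show "F * G = G * F"
  proof (transfer, rule ext)
    fix f g :: "nat multiset \<Rightarrow> 'a" and M
    show "(\<Sum>(A, B)\<in>splits M. f A * g B) = (\<Sum>(A, B)\<in>splits M. g A * f B)"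
      by (rule sum.reindex_bij_witness[of _ prod.swap prod.swap])
        (auto simp: splits_def ac_simps)
  qed
  show "1 * F = F"
  proof (transfer, rule ext)
    fix f :: "nat multiset \<Rightarrow> 'a" and M
    have "(\<Sum>(A, B)\<in>splits M. (if A = {#} then 1 else 0) * f B)
        = (\<Sum>(A :: nat multiset, B)\<in>{({#}, M)}. f B)"
      by (rule sum.mono_neutral_cong_right) (simp, auto simp: splits_def split: if_splits)
    then show "(\<Sum>(A, B)\<in>splits M. (if A = {#} then 1 else 0) * f B) = f M" by simp
  qed
  show "F * G * H = F * (G * H)"
  proof (transfer, rule ext)
    fix f g h :: "nat multiset \<Rightarrow> 'a" and M
    have "(\<Sum>(A, B)\<in>splits M. (\<Sum>(C, D)\<in>splits A. f C * g D) * h B)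
       = (\<Sum>((A, B), (C, D))\<in>(SIGMA p:splits M. splits (fst p)). f C * g D * h B)"
      by (simp add: sum.Sigma split_beta sum_distrib_right)
    also have "\<dots> = (\<Sum>((A, B), (C, D))\<in>(SIGMA p:splits M. splits (snd p)). f A * (g C * h D))"
      by (rule sum.reindex_bij_witness[of _ "\<lambda>((A, B), (C, D)). ((A + C, D), (A, C))"
            "\<lambda>((A, B), (C, D)). ((C, D + B), (D, B))"])
        (auto simp: splits_def ac_simps)
    also have "\<dots> = (\<Sum>(A, B)\<in>splits M. f A * (\<Sum>(C, D)\<in>splits B. g C * h D))"
      by (simp add: sum.Sigma split_beta sum_distrib_left)
    finally show "(\<Sum>(A, B)\<in>splits M. (\<Sum>(C, D)\<in>splits A. f C * g D) * h B)
       = (\<Sum>(A, B)\<in>splits M. f A * (\<Sum>(C, D)\<in>splits B. g C * h D))" .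
  qed
qed

end

lemma cf_0 [simp]: "cf 0 M = 0" and cf_1: "cf 1 M = (if M = {#} then 1 else 0)"
  and cf_add [simp]: "cf (F + G) M = cf F M + cf G M"
  and cf_diff [simp]: "cf (F - G) M = cf F M - cf G M"
  and cf_uminus [simp]: "cf (- F) M = - cf F M"
  and cf_mult: "cf (F * G) M = (\<Sum>(A, B)\<in>splits M. cf F A * cf G B)"
  by (transfer; simp)+

lemma cf_mult': "cf (F * G) M = (\<Sum>A | A \<subseteq># M. cf F A * cf G (M - A))"
  unfolding cf_mult splits_eq by (subst sum.reindex) (auto simp: inj_on_def)

lemma cf_sum [simp]: "cf (\<Sum>i\<in>I. F i) M = (\<Sum>i\<in>I. cf (F i) M)"
  by (induction I rule: infinite_finite_induct) auto

definition const :: "'a::comm_ring_1 \<Rightarrow> 'a series" where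
  "const c = Series (\<lambda>M. if M = {#} then c else 0)"

lemma cf_const: "cf (const c) M = (if M = {#} then c else 0)"
  by (simp add: const_def)

lemma cf_const_mult [simp]: "cf (const c * F) M = c * cf F M"
proof -
  have "cf (const c * F) M = (\<Sum>A\<in>{{#}}. c * cf F (M - A))"
    unfolding cf_mult' by (rule sum.mono_neutral_cong_right) (auto simp: finite_submultisets cf_const)
  then show ?thesis by simp
qed

lemma const_simps [simp]: "const 0 = 0" "const 1 = 1"
  by (auto intro!: series_eqI simp: cf_const cf_1)

lemma const_add: "const (a + b) = const a + const b"
  and const_diff: "const (a - b) = const a - const b"
  and const_uminus: "const (- a) = - const a"
  and const_mult: "const (a * b) = const a * const b"
  by (auto intro!: series_eqI simp: cf_const)

lemma const_power: "const (a ^ n) = const a ^ n"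
  by (induction n) (auto simp: const_mult)

lemma const_of_nat: "const (of_nat n) = of_nat n"
  by (induction n) (auto simp: const_add)

lemma cf_of_nat_mult [simp]: "cf (of_nat n * F) M = of_nat n * cf F M"
  by (simp flip: const_of_nat)

section \<open>Passage from exponent functions to multiset monomials\<close>

definition of_sf :: "'a::comm_ring_1 sf \<Rightarrow> 'a series" where
  "of_sf f = Series (\<lambda>M. f (count M))"

lemma cf_of_sf [simp]: "cf (of_sf f) M = f (count M)"
  by (simp add: of_sf_def)

lemma of_sf_one: "of_sf sf_one = 1"
  by (rule series_eqI) (auto simp: sf_one_def cf_1 multiset_eq_iff fun_eq_iff)

text \<open>Both factors of a decomposition of \<open>count M\<close> are bounded by
  \<open>count M\<close>, hence finitely supported, so the decompositions are exactly the pairs of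
  multisets with sum \<open>M\<close>.\<close>

lemma of_sf_mult: "of_sf (sf_mult f g) = of_sf f * of_sf g"
proof (rule series_eqI)
  fix M
  have *: "count (Abs_multiset a) = a" if "finite {i. a i \<noteq> 0}" for a :: "nat \<Rightarrow> nat"
    using that by (simp add: Abs_multiset_inverse neq0_conv)
  have fin: "finite {i. a i \<noteq> 0}" "finite {i. b i \<noteq> 0}"
    if "\<forall>i. a i + b i = count M i" for a b :: "nat \<Rightarrow> nat"
  proof -
    have "{i. a i \<noteq> 0} \<subseteq> set_mset M" "{i. b i \<noteq> 0} \<subseteq> set_mset M"
      using that by (auto simp flip: count_greater_zero_iff) (metis add_gr_0)+
    then show "finite {i. a i \<noteq> 0}" "finite {i. b i \<noteq> 0}" by (auto intro: finite_subset)
  qed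
  have inv: "count (Abs_multiset a) = a" "count (Abs_multiset b) = b"
    if "\<forall>i. a i + b i = count M i" for a b :: "nat \<Rightarrow> nat"
    using fin[OF that] by (auto intro: *)
  have "(\<Sum>(a, b)\<in>{(a, b). \<forall>i. a i + b i = count M i}. f a * g b)
      = (\<Sum>(A, B)\<in>splits M. f (count A) * g (count B))"
    by (rule sum.reindex_bij_witness[of _ "\<lambda>(A, B). (count A, count B)"
          "\<lambda>(a, b). (Abs_multiset a, Abs_multiset b)"])
      (auto simp: splits_def multiset_eq_iff count_inverse inv(1)[unfolded fun_eq_iff]
        inv(2)[unfolded fun_eq_iff] dest: inv, metis inv)
  then show "cf (of_sf (sf_mult f g)) M = cf (of_sf f * of_sf g) M"
    by (simp add: sf_mult_def cf_mult)
qed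

lemma of_sf_pow: "of_sf (sf_pow f n) = of_sf f ^ n"
  by (induction n) (auto simp: sf_pow_def of_sf_one of_sf_mult)

lemma of_sf_smult: "of_sf (sf_smult c f) = const c * of_sf f"
  by (rule series_eqI) (simp add: sf_smult_def)

lemma of_sf_sum: "of_sf (sf_sum F I) = (\<Sum>i\<in>I. of_sf (F i))"
  by (rule series_eqI) (simp add: sf_sum_def)

definition part_prod :: "(nat \<Rightarrow> 'a::comm_ring_1 series) \<Rightarrow> nat multiset \<Rightarrow> 'a series" where
  "part_prod b lam = prod_mset (image_mset b lam)"

lemma of_sf_part: "of_sf (sf_part b lam) = part_prod (\<lambda>n. of_sf (b n)) lam"
proof -
  have "of_sf (foldr (\<lambda>k acc. sf_mult (b k) acc) xs sf_one)
      = part_prod (\<lambda>n. of_sf (b n)) (mset xs)" for xs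
    by (induction xs) (auto simp: of_sf_one of_sf_mult part_prod_def)
  then show ?thesis by (simp add: sf_part_def)
qed

lemma of_sf_lincomb:
  "of_sf (sf_lincomb c B) = (\<Sum>lam | c lam \<noteq> 0. const (c lam) * of_sf (B lam))"
  by (simp add: sf_lincomb_def of_sf_sum of_sf_smult)

text \<open>Splitting off the full power of a single variable already gives infinitely many
  decompositions of \<open>m\<close>, and a sum over an infinite set is 0 by convention.\<close>

lemma sf_mult_infinite_support:
  fixes m :: "nat \<Rightarrow> nat"
  assumes "infinite {i. m i \<noteq> 0}"
  shows "sf_mult f g m = 0"
proof -
  let ?P = "{(a, b). \<forall>i. a i + b i = m i}"
  let ?a = "\<lambda>j i. if i = j then m i else 0"
  have "(\<lambda>j. (?a j, \<lambda>i. m i - ?a j i)) ` {i. m i \<noteq> 0} \<subseteq> ?P"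
    by auto
  moreover have "inj_on (\<lambda>j. (?a j, \<lambda>i. m i - ?a j i)) {i. m i \<noteq> 0}"
    by (rule inj_onI) (auto simp: fun_eq_iff split: if_splits)
  ultimately have "infinite ?P"
    using assms finite_imageD finite_subset by blast
  then show ?thesis by (simp add: sf_mult_def)
qed

text \<open>Even for a one-part partition the fold ends in a product with \<open>sf_one\<close>, so
  the values of \<open>b\<close> at monomials of infinite support never reach
  \<open>sf_part\<close>.\<close>

lemma sf_part_infinite_support:
  assumes "infinite {i. m i \<noteq> 0}"
  shows "sf_part b lam m = 0"
proof (cases "sorted_list_of_multiset lam")
  case Nil
  have "m \<noteq> (\<lambda>_. 0)" using assms by auto
  with Nil show ?thesis by (simp add: sf_part_def sf_one_def)
next
  case (Cons a list)
  then show ?thesis using assms by (simp add: sf_part_def sf_mult_infinite_support)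
qed

lemma of_sf_eqD:
  assumes "of_sf f = of_sf g"
    and "\<And>m. infinite {i. m i \<noteq> 0} \<Longrightarrow> f m = g m"
  shows "f = g"
proof (rule ext)
  fix m :: "nat \<Rightarrow> nat"
  show "f m = g m"
  proof (cases "finite {i. m i \<noteq> 0}")
    case True
    then have "count (Abs_multiset m) = m" by (simp add: Abs_multiset_inverse neq0_conv)
    then show ?thesis using arg_cong[OF assms(1), of "\<lambda>F. cf F (Abs_multiset m)"] by simp
  qed (use assms(2) in auto)
qed

section \<open>Graded algebras of symmetric functions\<close>

locale coeff_ring =
  fixes R :: "'a::comm_ring_1 set"
  assumes R_0: "0 \<in> R" and R_1: "1 \<in> R"
    and R_add: "a \<in> R \<Longrightarrow> b \<in> R \<Longrightarrow> a + b \<in> R"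
    and R_mult: "a \<in> R \<Longrightarrow> b \<in> R \<Longrightarrow> a * b \<in> R"
    and R_uminus: "a \<in> R \<Longrightarrow> - a \<in> R"
begin

lemma R_diff: "a \<in> R \<Longrightarrow> b \<in> R \<Longrightarrow> a - b \<in> R"
  using R_add[of a "- b"] R_uminus by simp

lemma R_sum: "(\<And>i. i \<in> I \<Longrightarrow> f i \<in> R) \<Longrightarrow> sum f I \<in> R"
  by (induction I rule: infinite_finite_induct) (auto intro: R_0 R_add)

lemma R_power: "a \<in> R \<Longrightarrow> a ^ n \<in> R"
  by (induction n) (auto intro: R_1 R_mult)

lemma R_of_nat: "of_nat n \<in> R"
  by (induction n) (auto intro: R_0 R_1 R_add)

end

text \<open>\<open>V n\<close> plays the role of the component of degree \<open>n\<close>. The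
  instance \<open>sym_hom R\<close> yields that generators are symmetric over \<open>R\<close>; the
  instance \<open>part_span R b\<close> yields that a given function is a polynomial in the
  generators \<open>b\<close>.\<close>

locale graded_algebra = coeff_ring R for R :: "'a::comm_ring_1 set" +
  fixes V :: "nat \<Rightarrow> 'a series set"
  assumes V_0: "0 \<in> V n"
    and V_1: "1 \<in> V 0"
    and V_add: "F \<in> V n \<Longrightarrow> G \<in> V n \<Longrightarrow> F + G \<in> V n"
    and V_const: "c \<in> R \<Longrightarrow> F \<in> V n \<Longrightarrow> const c * F \<in> V n"
    and V_mult: "F \<in> V m \<Longrightarrow> G \<in> V n \<Longrightarrow> F * G \<in> V (m + n)"
begin

lemma V_uminus: "F \<in> V n \<Longrightarrow> - F \<in> V n"
  using V_const[of "- 1" F] R_uminus[OF R_1] by (simp add: const_uminus)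

lemma V_diff: "F \<in> V n \<Longrightarrow> G \<in> V n \<Longrightarrow> F - G \<in> V n"
  using V_add[of F n "- G"] V_uminus by simp

lemma V_sum: "(\<And>i. i \<in> I \<Longrightarrow> F i \<in> V n) \<Longrightarrow> sum F I \<in> V n"
  by (induction I rule: infinite_finite_induct) (auto intro: V_0 V_add)

lemma V_power: "F \<in> V n \<Longrightarrow> F ^ k \<in> V (n * k)"
  by (induction k) (auto intro: V_1 V_mult)

lemma V_part_prod:
  "(\<And>k. k \<in># lam \<Longrightarrow> b k \<in> V k) \<Longrightarrow> part_prod b lam \<in> V (sum_mset lam)"
  by (induction lam) (auto simp: part_prod_def intro: V_1 V_mult)

end

section \<open>Partitions and the algebra generated by a family\<close>

definition partitions :: "nat \<Rightarrow> nat multiset set" where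
  "partitions n = {lam. lam \<in> Par \<and> sum_mset lam = n}"

lemma partitions_part_le: "lam \<in> partitions n \<Longrightarrow> k \<in># lam \<Longrightarrow> 1 \<le> k \<and> k \<le> n"
  using sum_mset.remove[of k lam] by (cases k) (auto simp: partitions_def Par_def)

text \<open>This is the source of triangularity: apart from the generator of index \<open>n\<close>
  itself, a product of weight \<open>n\<close> involves only generators of smaller index.\<close>

lemma partitions_part_less:
  assumes "lam \<in> partitions n" "lam \<noteq> {#n#}" "k \<in># lam"
  shows "1 \<le> k \<and> k < n"
proof -
  obtain mu where mu: "lam = add_mset k mu" using assms(3) by (metis insert_DiffM)
  with assms(1) have "k + sum_mset mu = n" "mu \<in> Par" "1 \<le> k"
    by (auto simp: partitions_def Par_def Suc_le_eq)
  moreover have "0 < sum_mset mu"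
  proof (rule ccontr)
    assume "\<not> 0 < sum_mset mu"
    then have "mu = {#}" using \<open>mu \<in> Par\<close>
      by (auto simp: Par_def sum_mset_0_iff) (metis multiset_nonemptyE)
    with assms(2) mu \<open>k + sum_mset mu = n\<close> show False by simp
  qed
  ultimately show ?thesis by linarith
qed

lemma finite_partitions [simp]: "finite (partitions n)"
proof (rule finite_subset)
  \<comment> \<open>A part \<open>k\<close> contributes \<open>count lam k * k\<close> to the sum
    \<open>n\<close>, so it is at most \<open>n\<close> and occurs at most \<open>n\<close>
    times.\<close>
  have "lam \<subseteq># (\<Sum>i\<le>n. replicate_mset n i)" if lam: "lam \<in> partitions n" for lam
  proof (rule mset_subset_eqI)
    fix k
    have "count lam k \<le> n" if "k \<in># lam"
    proof -
      have "lam = replicate_mset (count lam k) k + filter_mset (\<lambda>x. x \<noteq> k) lam"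
        by (rule multiset_eqI) auto
      then have "sum_mset lam = count lam k * k + sum_mset (filter_mset (\<lambda>x. x \<noteq> k) lam)"
        by (metis sum_mset.union sum_mset_replicate_mset of_nat_id)
      moreover have "sum_mset lam = n" using lam by (simp add: partitions_def)
      moreover have "count lam k * 1 \<le> count lam k * k"
        using partitions_part_le[OF lam that] by (intro mult_le_mono2) simp
      ultimately show ?thesis by linarith
    qed
    moreover have "count (\<Sum>i\<le>n. replicate_mset n i) k = (if k \<le> n then n else 0)"
      by (simp add: count_sum)
    ultimately show "count lam k \<le> count (\<Sum>i\<le>n. replicate_mset n i) k"
      using partitions_part_le[OF lam, of k] by (cases "k \<in># lam") (auto simp: not_in_iff)
  qed
  then show "partitions n \<subseteq> {lam. lam \<subseteq># (\<Sum>i\<le>n. replicate_mset n i)}" by auto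
qed (rule finite_submultisets)

text \<open>The component of degree \<open>n\<close> of the \<open>R\<close>-algebra generated by
  \<open>b 1\<close>, \<open>b 2\<close>, ..., where \<open>b k\<close> is given degree
  \<open>k\<close>.\<close>

definition part_span :: "'a::comm_ring_1 set \<Rightarrow> (nat \<Rightarrow> 'a series) \<Rightarrow> nat \<Rightarrow> 'a series set" where
  "part_span R b n = {\<Sum>lam\<in>partitions n. const (c lam) * part_prod b lam | c. \<forall>lam. c lam \<in> R}"

context coeff_ring
begin

lemma part_span_part_prod:
  assumes "lam \<in> partitions n"
  shows "part_prod b lam \<in> part_span R b n"
proof -
  let ?c = "\<lambda>mu. if mu = lam then 1 else 0"
  have "(\<Sum>mu\<in>partitions n. const (?c mu) * part_prod b mu)
      = (\<Sum>mu\<in>partitions n. if mu = lam then part_prod b mu else 0)"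
    by (rule sum.cong) auto
  also have "\<dots> = part_prod b lam" using assms by simp
  finally show ?thesis
    unfolding part_span_def mem_Collect_eq by (intro exI[of _ ?c]) (auto simp: R_0 R_1)
qed

lemma graded_algebra_part_span: "graded_algebra R (part_span R b)"
proof -
  have zero: "0 \<in> part_span R b n" for n
    unfolding part_span_def mem_Collect_eq by (intro exI[of _ "\<lambda>_. 0"]) (simp add: R_0)
  have add: "F + G \<in> part_span R b n" if FG: "F \<in> part_span R b n" "G \<in> part_span R b n" for F G n
  proof -
    obtain c d where "F = (\<Sum>lam\<in>partitions n. const (c lam) * part_prod b lam)"
      "G = (\<Sum>lam\<in>partitions n. const (d lam) * part_prod b lam)"
      "\<forall>lam. c lam \<in> R" "\<forall>lam. d lam \<in> R"
      using FG unfolding part_span_def by auto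
    then show ?thesis unfolding part_span_def mem_Collect_eq
      by (intro exI[of _ "\<lambda>lam. c lam + d lam"])
        (simp add: R_add const_add distrib_right sum.distrib)
  qed
  have scale: "const a * F \<in> part_span R b n" if aF: "a \<in> R" "F \<in> part_span R b n" for a F n
  proof -
    obtain c where "F = (\<Sum>lam\<in>partitions n. const (c lam) * part_prod b lam)"
      "\<forall>lam. c lam \<in> R"
      using aF unfolding part_span_def by auto
    then show ?thesis using aF(1) unfolding part_span_def mem_Collect_eq
      by (intro exI[of _ "\<lambda>lam. a * c lam"])
        (simp add: R_mult const_mult sum_distrib_left mult.assoc)
  qed
  have sum: "sum f I \<in> part_span R b n" if "\<And>i. i \<in> I \<Longrightarrow> f i \<in> part_span R b n"
    for f n and I :: "nat multiset set"
    using that by (induction I rule: infinite_finite_induct) (auto intro: zero add)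
  have one: "1 \<in> part_span R b 0"
    using part_span_part_prod[of "{#}" 0 b] by (simp add: part_prod_def partitions_def Par_def)
  have mult: "F * G \<in> part_span R b (m + n)"
    if FG: "F \<in> part_span R b m" "G \<in> part_span R b n" for F G m n
  proof -
    obtain c d where F: "F = (\<Sum>lam\<in>partitions m. const (c lam) * part_prod b lam)"
      and G: "G = (\<Sum>lam\<in>partitions n. const (d lam) * part_prod b lam)"
      and R: "\<forall>lam. c lam \<in> R" "\<forall>lam. d lam \<in> R"
      using FG unfolding part_span_def by auto
    have "F * G = (\<Sum>lam\<in>partitions m. \<Sum>mu\<in>partitions n.
        const (c lam * d mu) * part_prod b (lam + mu))"
      unfolding F G sum_product
      by (intro sum.cong refl) (simp add: const_mult part_prod_def algebra_simps)
    also have "\<dots> \<in> part_span R b (m + n)"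
      by (intro sum scale part_span_part_prod)
        (use R in \<open>auto simp: partitions_def Par_def intro: R_mult\<close>)
    finally show ?thesis .
  qed
  show ?thesis by unfold_locales (fact zero one add scale mult)+
qed

lemma part_span_gen:
  assumes "1 \<le> n"
  shows "b n \<in> part_span R b n"
  using assms part_span_part_prod[of "{#n#}" n b] by (simp add: part_prod_def partitions_def Par_def)

end

text \<open>Minimality of the generated algebra; it makes changes of generators transitive.\<close>

lemma (in graded_algebra) part_span_subset:
  assumes "\<And>k. 1 \<le> k \<Longrightarrow> b k \<in> V k"
  shows "part_span R b n \<subseteq> V n"
proof
  fix F assume "F \<in> part_span R b n"
  then obtain c where F: "F = (\<Sum>lam\<in>partitions n. const (c lam) * part_prod b lam)"
    and c: "\<forall>lam. c lam \<in> R" unfolding part_span_def by auto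
  show "F \<in> V n" unfolding F
  proof (intro V_sum V_const)
    fix lam assume lam: "lam \<in> partitions n"
    then have "part_prod b lam \<in> V (sum_mset lam)"
      by (intro V_part_prod assms) (auto dest: partitions_part_le)
    with lam show "part_prod b lam \<in> V n" by (simp add: partitions_def)
  qed (use c in auto)
qed

definition sym_hom :: "'a::comm_ring_1 set \<Rightarrow> nat \<Rightarrow> 'a series set" where
  "sym_hom R n = {F. (\<forall>M. cf F M \<in> R) \<and> (\<forall>M. cf F M \<noteq> 0 \<longrightarrow> size M = n) \<and>
     (\<forall>\<sigma> M. bij \<sigma> \<longrightarrow> cf F (image_mset \<sigma> M) = cf F M)}"

lemma cf_mult_image_mset:
  assumes "bij \<sigma>"
    and "\<And>M. cf F (image_mset \<sigma> M) = cf F M" "\<And>M. cf G (image_mset \<sigma> M) = cf G M"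
  shows "cf (F * G) (image_mset \<sigma> M) = cf (F * G) M"
proof -
  have inv: "inv \<sigma> (\<sigma> x) = x" "\<sigma> (inv \<sigma> x) = x" for x
    using assms(1) by (simp_all add: bij_is_inj bij_is_surj surj_f_inv_f)
  have inv': "image_mset (inv \<sigma>) (image_mset \<sigma> A) = A" "image_mset \<sigma> (image_mset (inv \<sigma>) A) = A" for A
    by (simp_all add: image_mset.compositionality comp_def inv)
  show ?thesis unfolding cf_mult
    by (rule sum.reindex_bij_witness[of _ "\<lambda>(A, B). (image_mset \<sigma> A, image_mset \<sigma> B)"
          "\<lambda>(A, B). (image_mset (inv \<sigma>) A, image_mset (inv \<sigma>) B)"])
      (auto simp: splits_def inv' assms(2,3) simp flip: image_mset_union,
        (metis assms(2,3) inv'(2))+)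
qed

lemma (in coeff_ring) graded_algebra_sym_hom: "graded_algebra R (sym_hom R)"
proof unfold_locales
  fix F G :: "'a series" and m n c
  show "0 \<in> sym_hom R n" "1 \<in> sym_hom R 0" by (auto simp: sym_hom_def cf_1 R_0 R_1)
  show "F \<in> sym_hom R n \<Longrightarrow> G \<in> sym_hom R n \<Longrightarrow> F + G \<in> sym_hom R n"
    unfolding sym_hom_def by (auto intro: R_add) (metis add_0)
  show "c \<in> R \<Longrightarrow> F \<in> sym_hom R n \<Longrightarrow> const c * F \<in> sym_hom R n"
    unfolding sym_hom_def by (auto intro: R_mult) (metis mult_zero_right)
  assume F: "F \<in> sym_hom R m" and G: "G \<in> sym_hom R n"
  have "size M = m + n" if "cf (F * G) M \<noteq> 0" for M
  proof -
    from that obtain A B where "(A, B) \<in> splits M" "cf F A * cf G B \<noteq> 0"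
      unfolding cf_mult by (metis (mono_tags, lifting) case_prod_unfold prod.collapse sum.neutral)
    then show ?thesis using F G unfolding sym_hom_def splits_def
      by auto (metis mult_zero_left mult_zero_right)
  qed
  moreover have "cf (F * G) M \<in> R" for M
    using F G unfolding cf_mult sym_hom_def by (auto intro!: R_sum R_mult)
  ultimately show "F * G \<in> sym_hom R (m + n)"
    using F G cf_mult_image_mset[of _ F G] unfolding sym_hom_def by auto
qed

section \<open>Elementary, complete and power-sum symmetric functions\<close>

definition elem_sym :: "nat \<Rightarrow> 'a::comm_ring_1 series" where
  "elem_sym n = Series (\<lambda>M. if (\<forall>i. count M i \<le> 1) \<and> size M = n then 1 else 0)"

definition compl_sym :: "nat \<Rightarrow> 'a::comm_ring_1 series" where
  "compl_sym n = Series (\<lambda>M. if size M = n then 1 else 0)"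

definition power_sym :: "nat \<Rightarrow> 'a::comm_ring_1 series" where
  "power_sym n = Series (\<lambda>M. if \<exists>i. M = replicate_mset n i then 1 else 0)"

lemma cf_elem_sym: "cf (elem_sym n) M = (if (\<forall>i. count M i \<le> 1) \<and> size M = n then 1 else 0)"
  by (simp add: elem_sym_def)

lemma cf_compl_sym: "cf (compl_sym n) M = (if size M = n then 1 else 0)"
  by (simp add: compl_sym_def)

lemma of_sf_psum: "of_sf (psum n) = power_sym n"
proof (rule series_eqI)
  fix M :: "nat multiset"
  have "(\<exists>i. count M = (\<lambda>j. if j = i then n else 0)) \<longleftrightarrow> (\<exists>i. M = replicate_mset n i)"
    by (auto simp: multiset_eq_iff fun_eq_iff)
  then show "cf (of_sf (psum n)) M = cf (power_sym n :: 'a series) M"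
    by (simp add: psum_def power_sym_def)
qed

lemma elem_sym_0: "elem_sym 0 = 1" and compl_sym_0: "compl_sym 0 = 1"
  by (auto intro!: series_eqI simp: cf_elem_sym cf_compl_sym cf_1)

lemma count_image_mset_inj: "inj f \<Longrightarrow> count (image_mset f M) (f x) = count M x"
  by (induction M) (auto simp: inj_eq)

lemma (in coeff_ring) compl_sym_sym_hom: "compl_sym n \<in> sym_hom R n"
  by (auto simp: sym_hom_def cf_compl_sym R_0 R_1)

lemma (in coeff_ring) power_sym_sym_hom: "power_sym n \<in> sym_hom R n"
proof -
  have "(\<exists>i. image_mset \<sigma> M = replicate_mset n i) \<longleftrightarrow> (\<exists>i. M = replicate_mset n i)"
    if "bij \<sigma>" for \<sigma> :: "nat \<Rightarrow> nat" and M
  proof -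
    have inj: "image_mset \<sigma> A = image_mset \<sigma> B \<longleftrightarrow> A = B" for A B
      using that by (metis bij_is_inj count_image_mset_inj multiset_eqI)
    have "(\<exists>i. image_mset \<sigma> M = replicate_mset n i)
        \<longleftrightarrow> (\<exists>i. image_mset \<sigma> M = replicate_mset n (\<sigma> i))"
      using that by (metis bij_pointE)
    also have "\<dots> \<longleftrightarrow> (\<exists>i. image_mset \<sigma> M = image_mset \<sigma> (replicate_mset n i))"
      by simp
    finally show ?thesis unfolding inj .
  qed
  then show ?thesis by (auto simp: sym_hom_def power_sym_def R_0 R_1)
qed

text \<open>The squarefree divisors of a monomial correspond to the subsets of its support; this
  turns products with \<open>elem_sym\<close> into sums over subsets.\<close>

lemma squarefree_submultisets:
  "{A. A \<subseteq># M \<and> (\<forall>i. count A i \<le> 1)} = mset_set ` Pow (set_mset M)"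
proof (intro equalityI subsetI)
  fix A assume A: "A \<in> {A. A \<subseteq># M \<and> (\<forall>i. count A i \<le> 1)}"
  have "A = mset_set (set_mset A)"
  proof (rule multiset_eqI)
    fix i show "count A i = count (mset_set (set_mset A)) i"
      using A by (cases "i \<in># A") (auto simp: not_in_iff le_antisym Suc_le_eq)
  qed
  moreover have "set_mset A \<subseteq> set_mset M" using A by (auto dest: mset_subset_eqD)
  ultimately show "A \<in> mset_set ` Pow (set_mset M)" by blast
next
  fix A assume "A \<in> mset_set ` Pow (set_mset M)"
  then obtain S where S: "S \<subseteq> set_mset M" "A = mset_set S" by auto
  then have "finite S" by (auto intro: finite_subset)
  with S show "A \<in> {A. A \<subseteq># M \<and> (\<forall>i. count A i \<le> 1)}"
    by (auto simp: count_mset_set' Suc_le_eq intro!: mset_subset_eqI)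
qed

lemma inj_on_mset_set_Pow: "finite S \<Longrightarrow> inj_on mset_set (Pow S)"
  by (rule inj_on_inverseI[of _ set_mset]) (auto dest: finite_subset)

lemma cf_elem_sym_mult:
  "cf (elem_sym n * F) M = (\<Sum>S | S \<subseteq> set_mset M \<and> card S = n. cf F (M - mset_set S))"
proof -
  have "cf (elem_sym n * F) M
      = (\<Sum>A\<in>mset_set ` {S. S \<subseteq> set_mset M \<and> card S = n}. cf F (M - A))"
    unfolding cf_mult'
  proof (rule sum.mono_neutral_cong_right)
    have *: "A \<in> mset_set ` {S. S \<subseteq> set_mset M \<and> card S = n}
        \<longleftrightarrow> A \<subseteq># M \<and> (\<forall>i. count A i \<le> 1) \<and> size A = n" for A
    proof -
      have "A \<in> mset_set ` {S. S \<subseteq> set_mset M \<and> card S = n}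
          \<longleftrightarrow> A \<in> mset_set ` Pow (set_mset M) \<and> size A = n"
        by auto
      then show ?thesis unfolding squarefree_submultisets[symmetric] by blast
    qed
    show "mset_set ` {S. S \<subseteq> set_mset M \<and> card S = n} \<subseteq> {A. A \<subseteq># M}"
      using * by blast
    show "\<forall>i\<in>{A. A \<subseteq># M} - mset_set ` {S. S \<subseteq> set_mset M \<and> card S = n}.
       cf (elem_sym n) i * cf F (M - i) = 0"
      using * by (auto simp: cf_elem_sym)
    show "cf (elem_sym n) A * cf F (M - A) = cf F (M - A)"
      if "A \<in> mset_set ` {S. S \<subseteq> set_mset M \<and> card S = n}" for A
      using that * by (auto simp: cf_elem_sym)
  qed (rule finite_submultisets)
  also have "\<dots> = (\<Sum>S | S \<subseteq> set_mset M \<and> card S = n. cf F (M - mset_set S))"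
    by (subst sum.reindex)
      (auto intro: inj_on_subset[OF inj_on_mset_set_Pow[of "set_mset M"]])
  finally show ?thesis .
qed

text \<open>This is E(-t) H(t) = 1. At a monomial of degree \<open>n\<close> the coefficient is the
  alternating count of the subsets of its support, that is, a positive power of 1 - 1.\<close>

lemma sum_elem_sym_compl_sym:
  assumes "1 \<le> n"
  shows "(\<Sum>i\<le>n. (-1) ^ i * elem_sym i * compl_sym (n - i)) = (0 :: 'a::comm_ring_1 series)"
proof (rule series_eqI)
  fix M :: "nat multiset"
  have c1: "(-1) ^ i = const ((-1) ^ i :: 'a)" for i
    by (simp add: const_power const_uminus)
  have summand: "cf ((-1) ^ i * elem_sym i * compl_sym (n - i)) M
      = (\<Sum>S | S \<subseteq> set_mset M \<and> card S = i. (-1) ^ i * (if size M = n then 1 else 0 :: 'a))"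
    if "i \<le> n" for i
  proof -
    have "size (M - mset_set S) = n - i \<longleftrightarrow> size M = n" if "S \<subseteq> set_mset M" "card S = i" for S
    proof -
      have "mset_set S \<subseteq># M"
        using squarefree_submultisets[of M] that by blast
      then have "size (M - mset_set S) = size M - i" "i \<le> size M"
        using that size_mset_mono[of "mset_set S" M] by (auto simp: size_Diff_submset)
      then show ?thesis using \<open>i \<le> n\<close> by auto
    qed
    then show ?thesis
      unfolding c1 mult.assoc cf_const_mult cf_elem_sym_mult sum_distrib_left
      by (intro sum.cong) (auto simp: cf_compl_sym)
  qed
  have "cf (\<Sum>i\<le>n. (-1) ^ i * elem_sym i * compl_sym (n - i)) M
      = (\<Sum>i\<le>n. \<Sum>S | S \<subseteq> set_mset M \<and> card S = i. (-1) ^ i * (if size M = n then 1 else 0 :: 'a))"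
    unfolding cf_sum by (intro sum.cong refl summand) auto
  also have "\<dots> = 0"
  proof (cases "size M = n")
    case True
    have le: "card S \<le> n" if "S \<subseteq> set_mset M" for S
    proof -
      have "mset_set S \<subseteq># M" using squarefree_submultisets[of M] that by blast
      then show ?thesis using size_mset_mono[of "mset_set S" M] True by simp
    qed
    have "(\<Sum>i\<le>n. \<Sum>S | S \<subseteq> set_mset M \<and> card S = i. (-1) ^ i * (if size M = n then 1 else 0 :: 'a))
      = (\<Sum>i\<le>n. \<Sum>S | S \<in> Pow (set_mset M) \<and> card S = i. (-1) ^ card S)"
      by (intro sum.cong) (auto simp: True)
    also have "\<dots> = (\<Sum>S\<in>Pow (set_mset M). (-1) ^ card S)"
      by (rule sum.group) (auto simp: le)
    also have "\<dots> = (\<Prod>x\<in>set_mset M. 1 - 1)"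
      by (subst prod_diff_conv_sum) auto
    also have "\<dots> = 0"
    proof -
      have "set_mset M \<noteq> {}" using True assms by auto
      then have "0 < card (set_mset M)" by (simp add: card_gt_0_iff)
      then show ?thesis by (simp add: zero_power)
    qed
    finally show ?thesis .
  qed auto
  finally show "cf (\<Sum>i\<le>n. (-1) ^ i * elem_sym i * compl_sym (n - i)) M = cf (0 :: 'a series) M"
    by simp
qed

text \<open>For positive \<open>k\<close> the powers \<open>replicate_mset k i\<close> are distinct
  for distinct \<open>i\<close>, so the sum over divisors can be indexed by variables; for
  \<open>k = 0\<close> they would all coincide.\<close>

lemma cf_power_sym_mult:
  assumes "1 \<le> k"
  shows "cf (power_sym k * F) M = (\<Sum>i | i \<in># M \<and> k \<le> count M i. cf F (M - replicate_mset k i))"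
proof -
  have "cf (power_sym k * F) M
      = (\<Sum>A\<in>replicate_mset k ` {i. i \<in># M \<and> k \<le> count M i}. cf F (M - A))"
    unfolding cf_mult'
  proof (rule sum.mono_neutral_cong_right)
    have *: "A \<in> replicate_mset k ` {i. i \<in># M \<and> k \<le> count M i}
        \<longleftrightarrow> A \<subseteq># M \<and> (\<exists>i. A = replicate_mset k i)" for A
    proof -
      have "k \<le> count M i \<longleftrightarrow> replicate_mset k i \<subseteq># M" for i
        by (simp add: count_le_replicate_mset_subset_eq)
      moreover have "i \<in># M" if "k \<le> count M i" for i
        using that assms by (simp flip: count_greater_zero_iff)
      ultimately show ?thesis by blast
    qed
    show "replicate_mset k ` {i. i \<in># M \<and> k \<le> count M i} \<subseteq> {A. A \<subseteq># M}"
      using * by blast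
    show "\<forall>i\<in>{A. A \<subseteq># M} - replicate_mset k ` {i. i \<in># M \<and> k \<le> count M i}.
       cf (power_sym k) i * cf F (M - i) = 0"
      using * by (auto simp: power_sym_def)
    show "cf (power_sym k) A * cf F (M - A) = cf F (M - A)"
      if "A \<in> replicate_mset k ` {i. i \<in># M \<and> k \<le> count M i}" for A
      using that * by (auto simp: power_sym_def)
  qed (rule finite_submultisets)
  also have "\<dots> = (\<Sum>i | i \<in># M \<and> k \<le> count M i. cf F (M - replicate_mset k i))"
  proof (subst sum.reindex)
    show "inj_on (replicate_mset k) {i. i \<in># M \<and> k \<le> count M i}"
      using assms by (auto intro!: inj_onI dest!: arg_cong[of _ _ set_mset] split: if_splits)
  qed simp
  finally show ?thesis .
qed

text \<open>Double counting: at a monomial \<open>M\<close> of degree \<open>n\<close> the right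
  side counts the pairs of a variable \<open>i\<close> and an exponent \<open>k\<close> between 1
  and \<open>count M i\<close>, and there are \<open>size M\<close> of them.\<close>

lemma newton_identity:
  "of_nat n * compl_sym n = (\<Sum>k=1..n. power_sym k * compl_sym (n - k) :: 'a::comm_ring_1 series)"
proof (rule series_eqI)
  fix M :: "nat multiset"
  have "cf (power_sym k * compl_sym (n - k)) M
      = (\<Sum>i\<in>set_mset M. if k \<le> count M i \<and> size M = n then 1 else 0 :: 'a)"
    if "k \<in> {1..n}" for k
  proof -
    have sz: "size (M - replicate_mset k i) = n - k \<longleftrightarrow> size M = n" if "k \<le> count M i" for i
    proof -
      have "replicate_mset k i \<subseteq># M" using that by (simp add: count_le_replicate_mset_subset_eq)
      then have "size (M - replicate_mset k i) = size M - k" "k \<le> size M"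
        using size_mset_mono[of "replicate_mset k i" M] by (auto simp: size_Diff_submset)
      then show ?thesis using \<open>k \<in> {1..n}\<close> by auto
    qed
    have "cf (power_sym k * compl_sym (n - k)) M
        = (\<Sum>i | i \<in># M \<and> k \<le> count M i. if size M = n then 1 else 0 :: 'a)"
      using that by (subst cf_power_sym_mult) (auto intro!: sum.cong simp: cf_compl_sym sz)
    also have "\<dots> = (\<Sum>i\<in>set_mset M. if k \<le> count M i \<and> size M = n then 1 else 0)"
      by (rule sum.mono_neutral_cong_left) auto
    finally show ?thesis .
  qed
  then have "cf (\<Sum>k=1..n. power_sym k * compl_sym (n - k)) M
      = (\<Sum>k=1..n. \<Sum>i\<in>set_mset M. if k \<le> count M i \<and> size M = n then 1 else 0 :: 'a)"
    by (simp only: cf_sum cong: sum.cong)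
  also have "\<dots> = (\<Sum>i\<in>set_mset M. \<Sum>k=1..n. if k \<le> count M i \<and> size M = n then 1 else 0)"
    by (rule sum.swap)
  also have "\<dots> = (if size M = n then of_nat n else 0)"
  proof (cases "size M = n")
    case True
    have "(\<Sum>k=1..n. if k \<le> count M i \<and> size M = n then 1 else 0 :: 'a) = of_nat (count M i)" for i
    proof -
      have "count M i \<le> n" using True count_le_size by metis
      then have "{1..n} \<inter> {k. k \<le> count M i} = {1..count M i}" by auto
      then show ?thesis using True by (simp add: sum.If_cases)
    qed
    then show ?thesis using True
      by (simp add: size_multiset_overloaded_eq flip: of_nat_sum)
  qed auto
  finally show "cf (of_nat n * compl_sym n) M
      = cf (\<Sum>k=1..n. power_sym k * compl_sym (n - k) :: 'a series) M"
    by (simp add: cf_compl_sym)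
qed

context graded_algebra
begin

text \<open>In E(-t) H(t) = 1 the elementary function of index \<open>n\<close> has coefficient 1 or
  -1, so solving for it works over every coefficient ring.\<close>

lemma elem_sym_mem:
  assumes "\<And>k. 1 \<le> k \<Longrightarrow> compl_sym k \<in> V k"
  shows "elem_sym n \<in> V n"
proof (induction n rule: less_induct)
  case (less n)
  show ?case
  proof (cases "n = 0")
    case True then show ?thesis by (simp add: elem_sym_0 V_1)
  next
    case False
    let ?s = "\<lambda>i. (-1) ^ i * elem_sym i * compl_sym (n - i) :: 'a series"
    have "?s i \<in> V n" if "i < n" for i
    proof -
      have "(-1) ^ i * elem_sym i \<in> V i"
        using V_const[OF R_power[OF R_uminus[OF R_1], of i] less[OF that]]
        by (simp add: const_power const_uminus)
      from V_mult[OF this assms[of "n - i"]] that show ?thesis by simp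
    qed
    then have "(\<Sum>i<n. ?s i) \<in> V n" by (intro V_sum) auto
    moreover have "elem_sym n = - ((-1) ^ n * (\<Sum>i<n. ?s i))"
    proof -
      have "(\<Sum>i<n. ?s i) + (-1) ^ n * elem_sym n = 0"
        using sum_elem_sym_compl_sym[of n, where 'a = 'a] False
        by (simp add: compl_sym_0 flip: lessThan_Suc_atMost)
      then have "(-1) ^ n * ((\<Sum>i<n. ?s i) + (-1) ^ n * elem_sym n) = 0" by simp
      then have "(-1) ^ n * (\<Sum>i<n. ?s i) + elem_sym n = 0"
        by (simp add: distrib_left flip: mult.assoc power_add)
      then show ?thesis by (simp add: add_eq_0_iff)
    qed
    moreover have "const ((-1) ^ n) * (\<Sum>i<n. ?s i) \<in> V n"
      by (rule V_const[OF R_power[OF R_uminus[OF R_1]]]) fact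
    ultimately show ?thesis by (simp add: V_uminus const_power const_uminus)
  qed
qed

end

section \<open>Orbits of monomials and generation by elementary symmetric functions\<close>

definition shape :: "nat multiset \<Rightarrow> nat multiset" where
  "shape M = image_mset (count M) (mset_set (set_mset M))"

lemma shape_image_mset:
  assumes "bij \<sigma>"
  shows "shape (image_mset \<sigma> M) = shape M"
proof -
  have inj: "inj \<sigma>" using assms by (rule bij_is_inj)
  have c: "count (image_mset \<sigma> M) (\<sigma> x) = count M x" for x
    using inj by (metis count_image_mset_inj)
  have "mset_set (\<sigma> ` set_mset M) = image_mset \<sigma> (mset_set (set_mset M))"
    using inj by (simp add: image_mset_mset_set inj_on_subset)
  then show ?thesis
    by (simp add: shape_def image_mset.compositionality comp_def c)
qed

lemma image_mset_count_superset:
  assumes "finite S" "set_mset M \<subseteq> S"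
  shows "image_mset (count M) (mset_set S) = shape M + replicate_mset (card S - card (set_mset M)) 0"
proof -
  have "mset_set S = mset_set (set_mset M) + mset_set (S - set_mset M)"
    using assms by (metis Diff_disjoint Diff_partition finite_Diff finite_set_mset mset_set_Union)
  moreover have "image_mset (count M) (mset_set (S - set_mset M))
      = image_mset (\<lambda>_. 0) (mset_set (S - set_mset M))"
    using assms by (intro image_mset_cong) (auto simp: not_in_iff)
  ultimately show ?thesis
    using assms by (simp add: shape_def image_mset_const_eq card_Diff_subset)
qed

lemma size_shape [simp]: "size (shape M) = card (set_mset M)"
  by (simp add: shape_def)

text \<open>Equal shapes force supports of equal size, so on the union of the supports both exponent
  functions are padded with equally many zeros. They then have the same multiset of values, and a
  permutation of that union matches them.\<close>

lemma shape_eqE: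
  assumes "shape M = shape N"
  obtains \<sigma> where "bij \<sigma>" "image_mset \<sigma> M = N"
proof -
  let ?A = "set_mset M \<union> set_mset N"
  have "card (set_mset M) = card (set_mset N)"
    using arg_cong[OF assms, of size] by simp
  then have "image_mset (count M) (mset_set ?A) = image_mset (count N) (mset_set ?A)"
    using assms by (simp add: image_mset_count_superset)
  then obtain p where p: "p permutes ?A" "\<forall>x\<in>?A. count M x = count N (p x)"
    using image_mset_eq_implies_permutes[of ?A "count M" "count N"] by auto
  have bij: "bij p" using p(1) by (rule permutes_bij)
  have eq: "count M x = count N (p x)" for x
  proof (cases "x \<in> ?A")
    case False
    then have "p x = x" using p(1) by (simp add: permutes_not_in)
    with False show ?thesis by (simp add: not_in_iff)
  qed (use p in auto)
  have "count (image_mset p M) y = count N y" for y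
  proof -
    obtain x where "y = p x" using bij by (metis bij_pointE)
    then show ?thesis using eq bij by (metis count_image_mset_inj bij_is_inj)
  qed
  then have "image_mset p M = N" by (rule multiset_eqI)
  with bij show ?thesis by (rule that)
qed

lemma sym_hom_shape:
  assumes "F \<in> sym_hom R n" "shape M = shape N"
  shows "cf F M = cf F N"
proof -
  obtain \<sigma> where "bij \<sigma>" "image_mset \<sigma> M = N" using shape_eqE[OF assms(2)] .
  with assms(1) show ?thesis by (auto simp: sym_hom_def)
qed

text \<open>Multiplying by the variables in \<open>S\<close> raises the padded exponents by one. The
  resulting shape depends on \<open>S\<close> only through its cardinality.\<close>

lemma shape_add_mset_set:
  assumes "finite S" "set_mset M \<subseteq> S"
  shows "shape (M + mset_set S)
    = image_mset Suc (shape M + replicate_mset (card S - card (set_mset M)) 0)"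
proof -
  have "set_mset (M + mset_set S) = S" using assms by auto
  moreover have "image_mset (count (M + mset_set S)) (mset_set S)
      = image_mset (\<lambda>x. Suc (count M x)) (mset_set S)"
    using assms by (intro image_mset_cong) auto
  ultimately have "shape (M + mset_set S) = image_mset Suc (image_mset (count M) (mset_set S))"
    by (simp add: shape_def image_mset.compositionality comp_def)
  then show ?thesis by (simp add: image_mset_count_superset[OF assms])
qed

text \<open>The fundamental theorem: divide the part of \<open>F\<close> supported on monomials in exactly \<open>k\<close>
  variables by the product of these variables, and extend the quotient to a symmetric \<open>G\<close>.  Then
  \<open>F - e\<^sub>k G\<close> lives on monomials in more than \<open>k\<close> variables, and \<open>G\<close> has smaller degree.\<close>

lemma (in graded_algebra) sym_hom_subset:
  assumes elem: "\<And>k. 1 \<le> k \<Longrightarrow> elem_sym k \<in> V k"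
  shows "F \<in> sym_hom R n \<Longrightarrow> F \<in> V n"
proof (induction n arbitrary: F rule: less_induct)
  case (less n)
  interpret S: graded_algebra R "sym_hom R" by (rule graded_algebra_sym_hom)
  have elemS: "elem_sym k \<in> sym_hom R k" for k
    by (rule S.elem_sym_mem) (rule compl_sym_sym_hom)
  show ?case
  proof (cases "n = 0")
    case True
    have "F = const (cf F {#}) * 1"
      using less.prems True by (auto intro!: series_eqI simp: cf_const sym_hom_def)
    then show ?thesis
      using V_const[OF _ V_1, of "cf F {#}"] less.prems True by (auto simp: sym_hom_def)
  next
    case False
    \<comment> \<open>Downward induction on \<open>k\<close>. At \<open>k = Suc n\<close> nothing is
      left, since a monomial of degree \<open>n\<close> involves at most \<open>n\<close>
      variables.\<close>
    have step: "F \<in> V n" if "F \<in> sym_hom R n" "1 \<le> k" "k \<le> Suc n"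
      "\<forall>M. card (set_mset M) < k \<longrightarrow> cf F M = 0" for F k
      using that
    proof (induction "Suc n - k" arbitrary: F k)
      case 0
      have "cf F M = 0" for M
      proof (rule ccontr)
        assume *: "cf F M \<noteq> 0"
        then have "size M = n" using 0 by (auto simp: sym_hom_def)
        then have "card (set_mset M) < k"
          using 0 size_mset_mono[of "mset_set (set_mset M)" M] by (simp add: mset_set_set_mset_msubset)
        with 0 * show False by blast
      qed
      then have "F = 0" by (intro series_eqI) simp
      then show ?case by (simp add: V_0)
    next
      case (Suc d)
      then have k: "1 \<le> k" "k \<le> n" by auto
      \<comment> \<open>The quotient of a monomial in \<open>k\<close> variables may involve fewer
        of them, so its support must be enlarged to \<open>k\<close> variables again. The arbitrary
        choice is harmless: a symmetric \<open>F\<close> sees only the shape, which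
        \<open>shape_add_mset_set\<close> shows to be independent of it.\<close>
      define S where "S M = (SOME S. finite S \<and> set_mset M \<subseteq> S \<and> card S = k)" for M :: "nat multiset"
      have S: "finite (S M)" "set_mset M \<subseteq> S M" "card (S M) = k" if "card (set_mset M) \<le> k" for M
      proof -
        have "\<exists>S. finite S \<and> set_mset M \<subseteq> S \<and> card S = k"
        proof -
          obtain T where "finite T" "card T = k - card (set_mset M)" "T \<subseteq> UNIV - set_mset M"
            using infinite_arbitrarily_large[of "UNIV - set_mset M" "k - card (set_mset M)"]
            by (auto simp: Diff_infinite_finite)
          then show ?thesis using that
            by (intro exI[of _ "set_mset M \<union> T"]) (subst card_Un_disjoint; auto)
        qed
        from someI_ex[OF this] show "finite (S M)" "set_mset M \<subseteq> S M" "card (S M) = k"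
          by (auto simp: S_def)
      qed
      define G where "G = Series (\<lambda>M. if card (set_mset M) \<le> k then cf F (M + mset_set (S M)) else 0)"
      have G: "cf G M = (if card (set_mset M) \<le> k then cf F (M + mset_set (S M)) else 0)" for M
        by (simp add: G_def)
      have "cf G M \<in> R" for M using Suc.prems(1) by (auto simp: G sym_hom_def R_0)
      moreover have "size M = n - k" if "cf G M \<noteq> 0" for M
      proof -
        have "card (set_mset M) \<le> k" "cf F (M + mset_set (S M)) \<noteq> 0"
          using that by (auto simp: G split: if_splits)
        then have "size (M + mset_set (S M)) = n" using Suc.prems(1) by (auto simp: sym_hom_def)
        then show ?thesis using S[OF \<open>card (set_mset M) \<le> k\<close>] by simp
      qed
      moreover have "cf G (image_mset \<sigma> M) = cf G M" if "bij \<sigma>" for \<sigma> M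
      proof -
        have sh: "shape (image_mset \<sigma> M) = shape M" using that by (rule shape_image_mset)
        then have card: "card (set_mset (image_mset \<sigma> M)) = card (set_mset M)"
          by (metis size_shape)
        have "shape (image_mset \<sigma> M + mset_set (S (image_mset \<sigma> M))) = shape (M + mset_set (S M))"
          if "card (set_mset M) \<le> k"
        proof -
          note S[OF that] S[of "image_mset \<sigma> M", unfolded card, OF that]
          then show ?thesis using card sh by (simp only: shape_add_mset_set)
        qed
        then have "cf F (image_mset \<sigma> M + mset_set (S (image_mset \<sigma> M))) = cf F (M + mset_set (S M))"
          if "card (set_mset M) \<le> k"
          using that by (intro sym_hom_shape[OF Suc.prems(1)])
        then show ?thesis unfolding G card by simp
      qed
      ultimately have GS: "G \<in> sym_hom R (n - k)" by (simp add: sym_hom_def)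
      then have "G \<in> V (n - k)" using k by (intro less.IH) auto
      from V_mult[OF elem[OF k(1)] this] k have eG: "elem_sym k * G \<in> V n" by simp
      have eGS: "elem_sym k * G \<in> sym_hom R n"
        using S.V_mult[OF elemS GS, of k] k by simp
      have "cf (F - elem_sym k * G) M = 0" if M: "card (set_mset M) < Suc k" for M
      proof (cases "card (set_mset M) = k")
        case False
        then have "{T. T \<subseteq> set_mset M \<and> card T = k} = {}"
          using M by (auto dest: card_mono[rotated])
        moreover have "cf F M = 0" using Suc.prems(4) False M by simp
        ultimately show ?thesis by (simp only: cf_diff cf_elem_sym_mult sum.empty diff_0_right)
      next
        \<comment> \<open>With exactly \<open>k\<close> variables in \<open>M\<close>, the only
          product of \<open>k\<close> distinct variables dividing it is that of its whole
          support.\<close>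
        case True
        then have "{T. T \<subseteq> set_mset M \<and> card T = k} = {set_mset M}"
          using card_subset_eq[of "set_mset M"] by auto
        then have "cf (elem_sym k * G) M = cf G (M - mset_set (set_mset M))"
          unfolding cf_elem_sym_mult by simp
        also have "\<dots> = cf F M"
        proof -
          define N where "N = M - mset_set (set_mset M)"
          have NM: "N + mset_set (set_mset M) = M"
            by (simp add: N_def mset_set_set_mset_msubset)
          have sub: "set_mset N \<subseteq> set_mset M" by (auto simp: N_def dest: in_diffD)
          then have le: "card (set_mset N) \<le> k" using True by (metis card_mono finite_set_mset)
          have "shape (N + mset_set (S N)) = shape (N + mset_set (set_mset M))"
            using S[OF le] sub True by (simp only: shape_add_mset_set finite_set_mset)
          then have "cf F (N + mset_set (S N)) = cf F M"
            using sym_hom_shape[OF Suc.prems(1), of "N + mset_set (S N)" M] NM by simp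
          then show ?thesis using le by (simp add: G flip: N_def)
        qed
        finally show ?thesis by simp
      qed
      then have "F - elem_sym k * G \<in> V n"
        using Suc.hyps(2) k S.V_diff[OF Suc.prems(1) eGS] by (intro Suc.hyps(1)[of "Suc k"]) auto
      from V_add[OF this eG] show ?case by simp
    qed
    moreover have "\<forall>M. card (set_mset M) < 1 \<longrightarrow> cf F M = 0"
      using less.prems False by (auto simp: sym_hom_def)
    ultimately show ?thesis using less.prems by (intro step[of F 1]) auto
  qed
qed

section \<open>Bases indexed by partitions\<close>

lemma sum_mset_shape: "sum_mset (shape M) = size M"
  by (simp add: shape_def size_multiset_overloaded_eq sum_unfold_sum_mset)

text \<open>Each new part \<open>k\<close> is realised as the exponent of a fresh variable, of which
  there are infinitely many.\<close>

lemma shape_surj: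
  assumes "lam \<in> Par"
  obtains M where "shape M = lam"
proof -
  have "\<exists>M. shape M = lam" using assms
  proof (induction lam)
    case empty
    show ?case by (rule exI[of _ "{#}"]) (simp add: shape_def)
  next
    case (add k lam)
    then obtain M where M: "shape M = lam" and k: "k \<noteq> 0" by (auto simp: Par_def)
    obtain x where x: "x \<notin># M" using ex_new_if_finite[of "set_mset M"] by auto
    have "shape (M + replicate_mset k x)
        = image_mset (count (M + replicate_mset k x)) (mset_set (insert x (set_mset M)))"
      using k by (simp add: shape_def)
    also have "\<dots> = add_mset k (image_mset (count (M + replicate_mset k x)) (mset_set (set_mset M)))"
      using x by (simp add: not_in_iff)
    also have "image_mset (count (M + replicate_mset k x)) (mset_set (set_mset M)) = shape M"
      unfolding shape_def using x by (intro image_mset_cong) auto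
    finally show ?case using M by blast
  qed
  then show ?thesis using that by blast
qed

lemma vector_space_series: "vector_space (\<lambda>c F. const c * F :: 'a::field series)"
  by unfold_locales (auto simp: algebra_simps const_add const_mult)

definition monomial_sym :: "nat multiset \<Rightarrow> 'a::comm_ring_1 series" where
  "monomial_sym lam = Series (\<lambda>M. if shape M = lam then 1 else 0)"

lemma monomial_sym_sym_hom:
  assumes "lam \<in> partitions n"
  shows "monomial_sym lam \<in> sym_hom UNIV n"
  using assms
  by (auto simp: sym_hom_def monomial_sym_def shape_image_mset partitions_def sum_mset_shape)

text \<open>Over a field the number of partitions of \<open>n\<close> bounds the dimension from below, so spanning
  families indexed by these partitions are independent.\<close>

lemma part_prod_independent:
  fixes B :: "nat \<Rightarrow> 'a::field series"
  assumes span: "sym_hom UNIV n \<subseteq> part_span UNIV B n"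
    and zero: "(\<Sum>lam\<in>partitions n. const (c lam) * part_prod B lam) = 0"
    and lam0: "lam0 \<in> partitions n"
  shows "c lam0 = 0"
proof (rule ccontr)
  assume c0: "c lam0 \<noteq> 0"
  interpret vs: vector_space "\<lambda>c F. const c * F :: 'a series" by (rule vector_space_series)
  let ?P = "partitions n" and ?m = "monomial_sym :: _ \<Rightarrow> 'a series"
  let ?T = "part_prod B ` (?P - {lam0})"
  \<comment> \<open>Reading the coefficient at a monomial of shape \<open>lam\<close> is the
    coordinate functional dual to \<open>monomial_sym lam\<close>; it gives both injectivity and
    independence.\<close>
  have ev: "\<exists>M. \<forall>mu. cf (?m mu) M = (if mu = lam then 1 else 0)" if "lam \<in> ?P" for lam
  proof -
    have "lam \<in> Par" using that by (simp add: partitions_def)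
    then obtain M where "shape M = lam" by (rule shape_surj)
    then show ?thesis by (intro exI[of _ M]) (auto simp: monomial_sym_def)
  qed
  have inj: "inj_on ?m ?P"
  proof (rule inj_onI)
    fix lam mu assume "lam \<in> ?P" "?m lam = ?m mu"
    with ev[of lam] show "lam = mu" by (metis zero_neq_one)
  qed
  have indep: "vs.independent (?m ` ?P)"
  proof (rule vs.independent_if_scalars_zero)
    fix f F assume f: "(\<Sum>F\<in>?m ` ?P. const (f F) * F) = 0" and "F \<in> ?m ` ?P"
    then obtain lam where lam: "lam \<in> ?P" "F = ?m lam" by auto
    obtain M where M: "\<And>mu. cf (?m mu) M = (if mu = lam then 1 else 0)"
      using ev[OF lam(1)] by auto
    have "0 = cf (\<Sum>mu\<in>?P. const (f (?m mu)) * ?m mu) M"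
      using f by (simp add: sum.reindex[OF inj])
    also have "\<dots> = f F" using lam by (simp add: M if_distrib cong: if_cong)
    finally show "f F = 0" by simp
  qed simp
  \<comment> \<open>A nonzero \<open>c lam0\<close> lets the relation be solved for this product, so
    \<open>?T\<close>, with fewer elements than there are partitions, spans everything.\<close>
  have "part_prod B lam0 \<in> vs.span ?T"
  proof -
    have "const (c lam0) * part_prod B lam0 + (\<Sum>lam\<in>?P - {lam0}. const (c lam) * part_prod B lam) = 0"
      using zero lam0 by (simp add: sum.remove)
    then have eq: "const (c lam0) * part_prod B lam0
        = - (\<Sum>lam\<in>?P - {lam0}. const (c lam) * part_prod B lam)"
      by (simp add: add_eq_0_iff)
    have "part_prod B lam0 = const (inverse (c lam0)) * (const (c lam0) * part_prod B lam0)"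
      using c0 by (simp flip: mult.assoc const_mult)
    also have "\<dots> \<in> vs.span ?T"
      unfolding eq by (intro vs.span_scale vs.span_neg vs.span_sum vs.span_base) auto
    finally show ?thesis .
  qed
  then have all: "part_prod B lam \<in> vs.span ?T" if "lam \<in> ?P" for lam
    using that by (cases "lam = lam0") (auto intro: vs.span_base)
  have "?m ` ?P \<subseteq> vs.span ?T"
  proof
    fix F assume "F \<in> ?m ` ?P"
    then have "F \<in> part_span UNIV B n" using span monomial_sym_sym_hom by auto
    then obtain d where "F = (\<Sum>lam\<in>?P. const (d lam) * part_prod B lam)"
      unfolding part_span_def by auto
    then show "F \<in> vs.span ?T" by (auto intro!: vs.span_sum vs.span_scale all)
  qed
  then have "card (?m ` ?P) \<le> card ?T"
    using vs.independent_span_bound[OF _ indep, of ?T] by simp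
  also have "\<dots> \<le> card (?P - {lam0})" by (rule card_image_le) simp
  also have "\<dots> < card ?P" using lam0 by (intro psubset_card_mono) auto
  finally show False using card_image[OF inj] by simp
qed

section \<open>From graded components to the basis property\<close>

lemma mdeg_count: "mdeg (count M) = size M"
  by (simp add: mdeg_def size_multiset_overloaded_eq flip: set_mset_def)

lemma count_image_mset_bij:
  assumes "bij \<sigma>"
  shows "count (image_mset \<sigma> M) \<circ> \<sigma> = count M"
  using count_image_mset_inj[OF bij_is_inj[OF assms]] by (auto simp: fun_eq_iff)

text \<open>Every exponent function is either \<open>count M\<close> for a multiset
  \<open>M\<close>, where membership in \<open>sym_hom\<close> applies, or of infinite support,
  where \<open>f\<close> vanishes.\<close>

lemma (in coeff_ring) is_symfunI:
  assumes F: "of_sf f \<in> sym_hom R n" and inf: "\<And>m. infinite {i. m i \<noteq> 0} \<Longrightarrow> f m = 0"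
  shows "is_symfun R f"
proof -
  have ex: "\<exists>M. m = count M" if "finite {i. m i \<noteq> 0}" for m :: "nat \<Rightarrow> nat"
  proof -
    have "count (Abs_multiset m) = m" using that by (simp add: Abs_multiset_inverse neq0_conv)
    then show ?thesis by metis
  qed
  have "mdeg m \<le> n" if m: "f m \<noteq> 0" for m
  proof -
    obtain M where M: "m = count M" using ex[of m] inf[of m] m by blast
    then have "size M = n" using F m by (auto simp: sym_hom_def)
    then show ?thesis by (simp add: M mdeg_count)
  qed
  moreover have "f (m \<circ> \<sigma>) = f m" if \<sigma>: "bij \<sigma>" for m \<sigma>
  proof (cases "finite {i. m i \<noteq> 0}")
    case True
    then obtain M where M: "m = count M" using ex by blast
    have "image_mset \<sigma> (image_mset (inv \<sigma>) M) = M"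
      using \<sigma> by (simp add: image_mset.compositionality comp_def bij_is_surj surj_f_inv_f)
    \<comment> \<open>Precomposing the exponent function with \<sigma> renames the variables by the
      inverse of \<sigma>.\<close>
    then have "m \<circ> \<sigma> = count (image_mset (inv \<sigma>) M)"
      using count_image_mset_bij[OF \<sigma>, of "image_mset (inv \<sigma>) M"] M by simp
    moreover have "cf (of_sf f) (image_mset (inv \<sigma>) M) = cf (of_sf f) M"
      using F bij_imp_bij_inv[OF \<sigma>] unfolding sym_hom_def by blast
    ultimately show ?thesis using M by simp
  next
    case False
    have "{i. m i \<noteq> 0} = \<sigma> ` {i. (m \<circ> \<sigma>) i \<noteq> 0}"
      using \<sigma> by (auto simp: image_iff) (metis bij_pointE)
    with False have "infinite {i. (m \<circ> \<sigma>) i \<noteq> 0}" using finite_imageI by metis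
    with False show ?thesis by (simp add: inf del: comp_apply)
  qed
  moreover have "f m \<in> R" for m
  proof (cases "finite {i. m i \<noteq> 0}")
    case True
    then obtain M where "m = count M" using ex by blast
    then show ?thesis using F by (auto simp: sym_hom_def)
  qed (simp add: inf R_0)
  ultimately show ?thesis using inf unfolding is_symfun_def by blast
qed

lemma (in coeff_ring) is_symfun_component:
  assumes "is_symfun R f"
  shows "Series (\<lambda>M. if size M = k then f (count M) else 0) \<in> sym_hom R k"
proof -
  have "f (count (image_mset \<sigma> M)) = f (count M)" if "bij \<sigma>" for \<sigma> M
    using assms that count_image_mset_bij[OF that, of M] unfolding is_symfun_def by metis
  then show ?thesis using assms by (auto simp: sym_hom_def is_symfun_def R_0)
qed

lemma coeff_ring_UNIV: "coeff_ring UNIV"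
  by unfold_locales auto

text \<open>Existence of coefficients is treated over \<open>R\<close> and uniqueness over the
  field; both spans come from the same hypothesis \<open>elem\<close>, since
  \<open>part_span\<close> grows with the coefficient ring.\<close>

lemma is_sf_basisI:
  fixes b :: "nat \<Rightarrow> 'a::field sf"
  assumes R: "coeff_ring R"
    and sym: "\<And>n. 1 \<le> n \<Longrightarrow> of_sf (b n) \<in> sym_hom R n"
    and elem: "\<And>n. 1 \<le> n \<Longrightarrow> elem_sym n \<in> part_span R (\<lambda>n. of_sf (b n)) n"
  shows "is_sf_basis R (sf_part b)"
proof -
  define B where "B = (\<lambda>n. of_sf (b n))"
  interpret coeff_ring R by fact
  interpret U: coeff_ring "UNIV :: 'a set" by (rule coeff_ring_UNIV)
  interpret S: graded_algebra R "sym_hom R" by (rule graded_algebra_sym_hom)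
  interpret P: graded_algebra R "part_span R B" by (rule graded_algebra_part_span)
  interpret UP: graded_algebra UNIV "part_span UNIV B" by (rule U.graded_algebra_part_span)
  have "part_span R B n \<subseteq> part_span UNIV B n" for n by (auto simp: part_span_def)
  then have UNIV_span: "sym_hom UNIV n \<subseteq> part_span UNIV B n" for n
    using UP.sym_hom_subset elem unfolding B_def by blast
  have R_span: "sym_hom R n \<subseteq> part_span R B n" for n
    using P.sym_hom_subset elem unfolding B_def by blast
  have part_sym: "part_prod B lam \<in> sym_hom R (sum_mset lam)" if "lam \<in> Par" for lam
    using that by (intro S.V_part_prod) (auto simp: B_def Par_def intro!: sym Suc_leI gr0I)
  have hom: "cf (part_prod B lam) M = 0" if "lam \<in> Par" "size M \<noteq> sum_mset lam" for lam M
    using part_sym[OF that(1)] that(2) by (auto simp: sym_hom_def)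
  have sym_part: "is_symfun R (sf_part b lam)" if "lam \<in> Par" for lam
    using part_sym[OF that] sf_part_infinite_support
    by (intro is_symfunI) (auto simp: of_sf_part B_def)
  have inf0: "sf_lincomb c (sf_part b) m = 0" if "infinite {i. m i \<noteq> 0}" for c m
    by (simp add: sf_lincomb_def sf_sum_def sf_smult_def sf_part_infinite_support[OF that])
  have ex: "\<exists>c. (\<forall>lam. c lam \<in> R) \<and> finite {lam. c lam \<noteq> 0} \<and> {lam. c lam \<noteq> 0} \<subseteq> Par
      \<and> f = sf_lincomb c (sf_part b)" if f: "is_symfun R f" for f
  proof -
    obtain d where d: "\<And>m. f m \<noteq> 0 \<Longrightarrow> mdeg m \<le> d" using f by (auto simp: is_symfun_def)
    define F where "F k = Series (\<lambda>M. if size M = k then f (count M) else 0)" for k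
    have "F k \<in> part_span R B k" for k
      using is_symfun_component[OF f, of k] R_span unfolding F_def by blast
    then have "\<forall>k. \<exists>c. F k = (\<Sum>lam\<in>partitions k. const (c lam) * part_prod B lam) \<and> (\<forall>lam. c lam \<in> R)"
      by (auto simp: part_span_def)
    then obtain cc where cc: "\<And>k. F k = (\<Sum>lam\<in>partitions k. const (cc k lam) * part_prod B lam)"
      "\<And>k lam. cc k lam \<in> R" by metis
    \<comment> \<open>The expansions of the homogeneous components are glued: a partition takes its
      coefficient from its own degree, and the degree bound \<open>d\<close> keeps the support
      finite.\<close>
    define c where "c lam = (if lam \<in> Par \<and> sum_mset lam \<le> d then cc (sum_mset lam) lam else 0)" for lam
    let ?U = "\<Union>k\<le>d. partitions k"
    have supp: "{lam. c lam \<noteq> 0} \<subseteq> ?U" by (auto simp: c_def partitions_def split: if_splits)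
    have finU: "finite ?U" by simp
    have "of_sf f = (\<Sum>k\<le>d. F k)"
    proof (rule series_eqI)
      fix M show "cf (of_sf f) M = cf (\<Sum>k\<le>d. F k) M"
        using d[of "count M"] by (auto simp: F_def mdeg_count)
    qed
    also have "\<dots> = (\<Sum>k\<le>d. \<Sum>lam\<in>partitions k. const (c lam) * part_prod B lam)"
      unfolding cc(1) by (intro sum.cong) (auto simp: c_def partitions_def)
    also have "\<dots> = (\<Sum>lam\<in>?U. const (c lam) * part_prod B lam)"
      by (subst sum.UNION_disjoint) (auto simp: partitions_def[of 0], auto simp: partitions_def)
    also have "\<dots> = (\<Sum>lam | c lam \<noteq> 0. const (c lam) * part_prod B lam)"
      by (rule sum.mono_neutral_right) (use supp finU in auto)
    also have "\<dots> = of_sf (sf_lincomb c (sf_part b))"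
      by (simp add: of_sf_lincomb of_sf_part B_def)
    finally have "f = sf_lincomb c (sf_part b)"
      by (rule of_sf_eqD) (use f inf0 in \<open>auto simp: is_symfun_def\<close>)
    moreover have "\<forall>lam. c lam \<in> R" by (simp add: c_def cc(2) R_0)
    moreover have "finite {lam. c lam \<noteq> 0}" using supp finU by (rule finite_subset)
    moreover have "{lam. c lam \<noteq> 0} \<subseteq> Par" by (auto simp: c_def split: if_splits)
    ultimately show ?thesis by blast
  qed
  have uniq: "c = d" if fin: "finite {lam. c lam \<noteq> 0}" "finite {lam. d lam \<noteq> 0}"
    and sub: "{lam. c lam \<noteq> 0} \<subseteq> Par" "{lam. d lam \<noteq> 0} \<subseteq> Par"
    and eq: "sf_lincomb c (sf_part b) = sf_lincomb d (sf_part b)" for c d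
  proof (rule ext)
    fix lam0 show "c lam0 = d lam0"
    proof (cases "lam0 \<in> Par")
      case False
      then have "c lam0 = 0" "d lam0 = 0" using sub by blast+
      then show ?thesis by simp
    next
      case True
      let ?U = "{lam. c lam \<noteq> 0} \<union> {lam. d lam \<noteq> 0}" and ?n = "sum_mset lam0"
      have "of_sf (sf_lincomb e (sf_part b)) = (\<Sum>lam\<in>?U. const (e lam) * part_prod B lam)"
        if "{lam. e lam \<noteq> 0} \<subseteq> ?U" for e
        unfolding of_sf_lincomb of_sf_part B_def[symmetric]
        by (rule sum.mono_neutral_left) (use that fin in auto)
      from this[of c] this[of d]
      have U: "(\<Sum>lam\<in>?U. const (c lam - d lam) * part_prod B lam) = 0"
        using eq by (simp add: const_diff left_diff_distrib sum_subtractf)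
      \<comment> \<open>Products of different weights share no monomial, so the component of degree
        \<open>?n\<close> of the relation \<open>U\<close> is itself a relation.\<close>
      have "(\<Sum>lam\<in>partitions ?n. const (c lam - d lam) * part_prod B lam) = 0"
      proof (rule series_eqI)
        fix M
        show "cf (\<Sum>lam\<in>partitions ?n. const (c lam - d lam) * part_prod B lam) M = cf 0 M"
        proof (cases "size M = ?n")
          case False
          then show ?thesis by (auto simp: partitions_def hom intro!: sum.neutral)
        next
          case True
          have "(\<Sum>lam\<in>partitions ?n. (c lam - d lam) * cf (part_prod B lam) M)
              = (\<Sum>lam\<in>partitions ?n \<inter> ?U. (c lam - d lam) * cf (part_prod B lam) M)"
            by (rule sum.mono_neutral_right) auto
          also have "\<dots> = (\<Sum>lam\<in>?U. (c lam - d lam) * cf (part_prod B lam) M)"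
          proof (rule sum.mono_neutral_left)
            show "\<forall>lam\<in>?U - partitions ?n \<inter> ?U. (c lam - d lam) * cf (part_prod B lam) M = 0"
            proof
              fix lam assume "lam \<in> ?U - partitions ?n \<inter> ?U"
              then have "lam \<in> Par" "sum_mset lam \<noteq> ?n" using sub by (auto simp: partitions_def)
              then show "(c lam - d lam) * cf (part_prod B lam) M = 0"
                using hom[of lam M] True by simp
            qed
          qed (use fin in auto)
          also have "\<dots> = 0" using arg_cong[OF U, of "\<lambda>F. cf F M"] by simp
          finally show ?thesis by simp
        qed
      qed
      from part_prod_independent[OF UNIV_span this, of lam0] True show ?thesis
        by (simp add: partitions_def)
    qed
  qed
  show ?thesis unfolding is_sf_basis_def
  proof (intro conjI ballI allI impI)
    fix f assume "is_symfun R f"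
    from ex[OF this] uniq
    show "\<exists>!c. (\<forall>lam. c lam \<in> R) \<and> finite {lam. c lam \<noteq> 0} \<and> {lam. c lam \<noteq> 0} \<subseteq> Par
      \<and> f = sf_lincomb c (sf_part b)"
      by (smt (verit, ccfv_threshold))
  qed (rule sym_part)
qed

section \<open>The logarithmic derivative of the generating functions\<close>

unbundle fps_syntax

text \<open>The expansion of z t^d / (1 - z t^d), which has no constant term. It is given by
  coefficients because the base will be a ring of series in the variables, not a field.\<close>

definition geometric :: "'a::comm_ring_1 \<Rightarrow> nat \<Rightarrow> 'a fps" where
  "geometric z d = Abs_fps (\<lambda>n. if n \<noteq> 0 \<and> d dvd n then z ^ (n div d) else 0)"

lemma geometric_eq:
  assumes "1 \<le> d"
  shows "(1 - fps_const z * fps_X ^ d) * geometric z d = fps_const z * fps_X ^ d"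
proof (rule fps_ext)
  fix n
  have "((1 - fps_const z * fps_X ^ d) * geometric z d) $ n
      = geometric z d $ n - z * (if n < d then 0 else geometric z d $ (n - d))"
    by (simp add: left_diff_distrib mult.assoc fps_X_power_mult_nth)
  also have "\<dots> = (fps_const z * fps_X ^ d) $ n"
  proof -
    consider "n < d" | "n = d" | "n > d" by linarith
    then show ?thesis
    proof cases
      case 1 then show ?thesis by (auto simp: geometric_def dest: dvd_imp_le)
    next
      case 2 with assms show ?thesis by (simp add: geometric_def)
    next
      case 3
      then have "d dvd n - d \<longleftrightarrow> d dvd n" by (simp add: dvd_minus_self)
      moreover have "n div d = Suc ((n - d) div d)" using 3 assms by (simp add: le_div_geq)
      ultimately show ?thesis using 3 by (simp add: geometric_def)
    qed
  qed
  finally show "((1 - fps_const z * fps_X ^ d) * geometric z d) $ n = (fps_const z * fps_X ^ d) $ n" .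
qed

text \<open>Compare coefficients from the lowest one upwards. This permits clearing denominators of
  constant term 1 over any commutative ring.\<close>

lemma fps_mult_eq_0_cancel:
  fixes A Z :: "'a::comm_ring_1 fps"
  assumes "A $ 0 = 1" "A * Z = 0"
  shows "Z = 0"
proof -
  have "Z $ n = 0" for n
  proof (induction n rule: less_induct)
    case (less n)
    have "0 = (\<Sum>i=0..n. A $ i * Z $ (n - i))"
      using assms(2) by (simp flip: fps_mult_nth)
    also have "\<dots> = (\<Sum>i\<in>{0}. A $ i * Z $ (n - i))"
      by (rule sum.mono_neutral_right) (auto simp: less)
    finally show ?case using assms(1) by simp
  qed
  then show ?thesis by (intro fps_ext) simp
qed

text \<open>The factor is \<open>(1 - q z t\<^sup>d) / (1 - z t\<^sup>d)\<close>.\<close>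

lemma factor_log_deriv:
  fixes q z :: "'a::comm_ring_1"
  assumes d: "1 \<le> d"
  shows "fps_X * fps_deriv (1 + fps_const (1 - q) * geometric z d)
    = (1 + fps_const (1 - q) * geometric z d) * (of_nat d * (geometric z d - geometric (q * z) d))"
    (is "fps_X * fps_deriv ?L = ?L * ?D")
proof -
  define y where "y = fps_const z * fps_X ^ d"
  define Q where "Q = fps_const q"
  have Q: "fps_const (1 - q) = 1 - Q" "fps_const (q * z) * fps_X ^ d = Q * y"
    by (simp_all add: Q_def y_def mult.assoc flip: fps_const_sub fps_const_mult)
  have g1: "(1 - y) * geometric z d = y"
    using geometric_eq[OF d, of z] by (simp add: y_def)
  have g2: "(1 - Q * y) * geometric (q * z) d = Q * y"
    using geometric_eq[OF d, of "q * z"] by (simp only: Q)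
  have X: "fps_X * fps_deriv y = of_nat d * y"
  proof -
    have "fps_X * fps_deriv y = of_nat d * (fps_const z * fps_X ^ Suc (d - 1))"
      by (simp add: y_def fps_deriv_power' mult_ac)
    then show ?thesis using d by (simp add: y_def)
  qed
  have dQ: "fps_deriv Q = 0" by (simp add: Q_def)
  define G H L where "G = geometric z d" and "H = geometric (q * z) d" and "L = ?L"
  define E where "E = fps_X * fps_deriv L"
  have L': "L = 1 + (1 - Q) * G" by (simp only: L_def G_def Q)
  have "(1 - y) * L = (1 - y) + (1 - Q) * ((1 - y) * G)"
    by (simp add: L' algebra_simps)
  then have L: "(1 - y) * L = 1 - Q * y"
    using g1 by (simp only: G_def) (simp add: algebra_simps)
  \<comment> \<open>Differentiating the product form \<open>(1 - y) * L = 1 - Q * y\<close> avoids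
    the quotient rule.\<close>
  have "(1 - y) * (fps_X * fps_deriv L) - (fps_X * fps_deriv y) * L = fps_X * fps_deriv ((1 - y) * L)"
    by (simp add: algebra_simps)
  also have "\<dots> = - Q * (fps_X * fps_deriv y)"
    unfolding L by (simp add: dQ algebra_simps)
  finally have "(1 - y) * (fps_X * fps_deriv L) = - Q * (of_nat d * y) + of_nat d * y * L"
    unfolding X by (simp only: diff_eq_eq)
  also have "\<dots> = of_nat d * y * (L - Q)"
    by (simp add: algebra_simps)
  finally have dL: "(1 - y) * E = of_nat d * y * (L - Q)" by (simp only: E_def)
  \<comment> \<open>The square clears the denominators of both \<open>E\<close> and
    \<open>L * G\<close>. The denominator \<open>1 - Q * y\<close> of \<open>H\<close> cancels
    against the numerator of \<open>L\<close>.\<close>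
  have "((1 - y) * (1 - y)) * (E - L * (of_nat d * (G - H)))
      = (1 - y) * ((1 - y) * E)
        - of_nat d * ((1 - y) * L) * ((1 - y) * G - (1 - y) * H)"
    by (simp add: algebra_simps)
  also have "\<dots> = (1 - y) * (of_nat d * y * (L - Q)) - of_nat d * (1 - Q * y) * (y - (1 - y) * H)"
    using g1 by (simp only: dL L G_def)
  also have "\<dots> = of_nat d * y * ((1 - y) * L - (1 - y) * Q)
        - of_nat d * ((1 - Q * y) * y - (1 - y) * ((1 - Q * y) * H))"
    by (simp add: algebra_simps)
  also have "\<dots> = of_nat d * y * (1 - Q * y - (1 - y) * Q)
        - of_nat d * ((1 - Q * y) * y - (1 - y) * (Q * y))"
    using g2 by (simp only: L H_def)
  also have "\<dots> = 0" by (simp add: algebra_simps)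
  finally have "((1 - y) * (1 - y)) * (fps_X * fps_deriv ?L - ?L * ?D) = 0"
    by (simp only: E_def G_def H_def L_def)
  moreover have "((1 - y) * (1 - y)) $ 0 = 1" using d by (simp add: y_def)
  ultimately have "fps_X * fps_deriv ?L - ?L * ?D = 0" by (rule fps_mult_eq_0_cancel[rotated])
  then show ?thesis by (simp only: right_minus_eq)
qed

text \<open>A finite product suffices: the factor of index \<open>d\<close> is 1 up to terms of
  order \<open>d\<close>, so the coefficient of t^n is the same for all \<open>N\<close> from
  \<open>n\<close> on.\<close>

definition fac_prod :: "'a::comm_ring_1 \<Rightarrow> (nat \<Rightarrow> 'a) \<Rightarrow> nat \<Rightarrow> 'a fps" where
  "fac_prod q w N = (\<Prod>d=1..N. 1 + fps_const (1 - q) * geometric (w d) d)"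

lemma fac_prod_Suc:
  "fac_prod q w (Suc N) = fac_prod q w N * (1 + fps_const (1 - q) * geometric (w (Suc N)) (Suc N))"
  by (simp add: fac_prod_def)

lemma fac_prod_nth_0: "fac_prod q w N $ 0 = 1"
  by (induction N) (simp_all add: fac_prod_Suc, simp_all add: fac_prod_def geometric_def)

lemma fac_prod_log_deriv:
  "fps_X * fps_deriv (fac_prod q w N)
    = fac_prod q w N * (\<Sum>d=1..N. of_nat d * (geometric (w d) d - geometric (q * w d) d))"
proof (induction N)
  case 0 then show ?case by (simp add: fac_prod_def)
next
  case (Suc N)
  let ?L = "1 + fps_const (1 - q) * geometric (w (Suc N)) (Suc N)"
  have L: "fps_X * fps_deriv ?L
      = ?L * (of_nat (Suc N) * (geometric (w (Suc N)) (Suc N) - geometric (q * w (Suc N)) (Suc N)))"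
    by (rule factor_log_deriv) simp
  have "fps_X * fps_deriv (fac_prod q w (Suc N))
      = (fps_X * fps_deriv (fac_prod q w N)) * ?L + fac_prod q w N * (fps_X * fps_deriv ?L)"
    unfolding fac_prod_Suc fps_deriv_mult by (simp only: algebra_simps)
  also have "\<dots> = fac_prod q w (Suc N)
      * (\<Sum>d=1..Suc N. of_nat d * (geometric (w d) d - geometric (q * w d) d))"
    unfolding Suc L by (simp add: fac_prod_Suc algebra_simps del: of_nat_Suc)
  finally show ?case .
qed

text \<open>The coefficient of t^k in the logarithmic derivative is the divisor sum in
  \<open>p\<close>. The bound \<open>n \<le> N\<close> ensures that every divisor of every
  \<open>k \<le> n\<close> occurs among the factors.\<close>

lemma fac_prod_recursion:
  assumes "1 \<le> n" "n \<le> N"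
    and p: "\<And>k. 1 \<le> k \<Longrightarrow> (\<Sum>d | d dvd k. of_nat d * (1 - q ^ (k div d)) * w d ^ (k div d)) = p k"
  shows "of_nat n * fac_prod q w N $ n = (\<Sum>k=1..n. p k * fac_prod q w N $ (n - k))"
proof -
  define D where "D = (\<Sum>d=1..N. of_nat d * (geometric (w d) d - geometric (q * w d) d))"
  have of_nat: "(of_nat d * f) $ k = of_nat d * f $ k" for d k and f :: "'a fps"
    by (simp flip: fps_of_nat)
  have D: "D $ k = (if k = 0 then 0 else p k)" if "k \<le> n" for k
  proof (cases "k = 0")
    case True then show ?thesis by (simp add: D_def fps_sum_nth of_nat geometric_def)
  next
    case False
    have "D $ k = (\<Sum>d=1..N. if d dvd k then of_nat d * (1 - q ^ (k div d)) * w d ^ (k div d) else 0)"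
      unfolding D_def fps_sum_nth of_nat using False
      by (intro sum.cong) (auto simp: geometric_def power_mult_distrib algebra_simps)
    also have "\<dots> = (\<Sum>d | d dvd k. of_nat d * (1 - q ^ (k div d)) * w d ^ (k div d))"
    proof (rule sum.mono_neutral_cong_right)
      show "{d. d dvd k} \<subseteq> {1..N}"
      proof
        fix d assume "d \<in> {d. d dvd k}"
        with False have "d \<le> k" "d \<noteq> 0" by (auto intro: dvd_imp_le)
        with that assms(2) show "d \<in> {1..N}" by simp
      qed
    qed auto
    finally show ?thesis using p[of k] False by simp
  qed
  have "of_nat n * fac_prod q w N $ n = (D * fac_prod q w N) $ n"
    using arg_cong[OF fac_prod_log_deriv[of q w N], of "\<lambda>f. f $ n"] assms(1)
    by (simp add: D_def mult.commute)
  also have "\<dots> = (\<Sum>k=0..n. D $ k * fac_prod q w N $ (n - k))"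
    by (rule fps_mult_nth)
  also have "\<dots> = (\<Sum>k=1..n. p k * fac_prod q w N $ (n - k))"
    by (rule sum.mono_neutral_cong_right) (auto simp: D)
  finally show ?thesis .
qed

lemma of_nat_mult_cancel:
  fixes F G :: "'a::field_char_0 series"
  assumes "of_nat n * F = of_nat n * G" "1 \<le> n"
  shows "F = G"
  using assms by (auto intro!: series_eqI dest!: arg_cong[of _ _ cf] simp: fun_eq_iff)

text \<open>Both sides satisfy Newton's recursion with constant term 1. The division by
  \<open>n\<close> takes place in the ambient field and only establishes an equality, so it leaves
  no trace in the coefficient ring.\<close>

lemma fac_prod_eq_compl_sym:
  fixes q :: "'a::field_char_0 series"
  assumes p: "\<And>k. 1 \<le> k \<Longrightarrow>
      (\<Sum>d | d dvd k. of_nat d * (1 - q ^ (k div d)) * w d ^ (k div d)) = power_sym k"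
  shows "n \<le> N \<Longrightarrow> fac_prod q w N $ n = compl_sym n"
proof (induction n rule: less_induct)
  case (less n)
  show ?case
  proof (cases "n = 0")
    case True then show ?thesis by (simp add: fac_prod_nth_0 compl_sym_0)
  next
    case False
    then have "of_nat n * fac_prod q w N $ n = (\<Sum>k=1..n. power_sym k * fac_prod q w N $ (n - k))"
      using less.prems p by (intro fac_prod_recursion) auto
    also have "\<dots> = of_nat n * compl_sym n"
      unfolding newton_identity using less by (intro sum.cong) auto
    finally show ?thesis by (rule of_nat_mult_cancel) (use False in simp)
  qed
qed

lemma (in graded_algebra) fac_prod_mem:
  assumes q: "q \<in> R" and w: "\<And>d. 1 \<le> d \<Longrightarrow> d \<le> N \<Longrightarrow> w d \<in> V d"
  shows "fac_prod (const q) w N $ n \<in> V n"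
  using w
proof (induction N arbitrary: n)
  case 0
  show ?case by (cases n) (auto simp: fac_prod_def V_0 V_1)
next
  case (Suc N)
  let ?L = "1 + fps_const (1 - const q) * geometric (w (Suc N)) (Suc N)"
  have L: "?L $ k \<in> V k" for k
  proof (cases "k \<noteq> 0 \<and> Suc N dvd k")
    case True
    have "w (Suc N) ^ (k div Suc N) \<in> V (Suc N * (k div Suc N))"
      using Suc.prems by (intro V_power) auto
    with True have "w (Suc N) ^ (k div Suc N) \<in> V k" by (simp only: dvd_mult_div_cancel)
    from V_const[OF R_diff[OF R_1 q] this] True show ?thesis
      by (simp add: geometric_def const_diff)
  next
    case False
    then show ?thesis using V_0 V_1 by (cases k) (auto simp: geometric_def)
  qed
  have "fac_prod (const q) w N $ i * ?L $ (n - i) \<in> V n" if "i \<le> n" for i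
  proof -
    have "fac_prod (const q) w N $ i \<in> V i" using Suc by simp
    from V_mult[OF this L, of "n - i"] that show ?thesis by simp
  qed
  then show ?case unfolding fac_prod_Suc fps_mult_nth by (intro V_sum) auto
qed

text \<open>Up to order \<open>n\<close> the last factor is 1 + (1 - q) w_n t^n, so the newest
  generator enters linearly with coefficient \<open>1 - q\<close>.\<close>

lemma fac_prod_leading:
  assumes "1 \<le> n"
  shows "fac_prod q w n $ n = fac_prod q w (n - 1) $ n + (1 - q) * w n"
proof -
  let ?L = "1 + fps_const (1 - q) * geometric (w n) n"
  have "fac_prod q w n = fac_prod q w (n - 1) * ?L"
    using assms fac_prod_Suc[of q w "n - 1"] by simp
  then have "fac_prod q w n $ n = (\<Sum>i=0..n. fac_prod q w (n - 1) $ i * ?L $ (n - i))"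
    by (simp only: fps_mult_nth)
  also have "\<dots> = (\<Sum>i\<in>{0, n}. fac_prod q w (n - 1) $ i * ?L $ (n - i))"
    by (rule sum.mono_neutral_right) (auto simp: geometric_def dest: dvd_imp_le)
  also have "\<dots> = fac_prod q w (n - 1) $ n + (1 - q) * w n"
    using assms by (simp add: fac_prod_nth_0, simp add: geometric_def)
  finally show ?thesis .
qed

section \<open>Triangular changes of generators\<close>

lemma (in graded_algebra) sum_proper_divisors_mem:
  assumes "\<And>d. 1 \<le> d \<Longrightarrow> d < n \<Longrightarrow> w d \<in> V d" "\<And>d. c d \<in> R" "1 \<le> n"
  shows "(\<Sum>d | d dvd n \<and> d < n. const (c d) * w d ^ (n div d)) \<in> V n"
proof (intro V_sum V_const)
  fix d assume "d \<in> {d. d dvd n \<and> d < n}"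
  then have d: "d dvd n" "d < n" "1 \<le> d" using assms(3) by (auto intro!: Suc_leI gr0I)
  from V_power[OF assms(1)[OF d(3,2)], of "n div d"] d show "w d ^ (n div d) \<in> V n" by simp
qed (use assms in auto)

lemma sum_divisors_top:
  fixes f :: "nat \<Rightarrow> 'a::comm_monoid_add"
  assumes "1 \<le> n"
  shows "(\<Sum>d | d dvd n. f d) = f n + (\<Sum>d | d dvd n \<and> d < n. f d)"
proof -
  have "{d. d dvd n} = insert n {d. d dvd n \<and> d < n}" using assms by (auto dest: dvd_imp_le)
  moreover have "finite {d. d dvd n \<and> d < n}" by simp
  ultimately show ?thesis by simp
qed

text \<open>Since \<open>a 1 = 1\<close>, the equation of index \<open>n\<close> is
  \<open>n * w n\<close> plus powers of generators at proper divisors of \<open>n\<close>; the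
  inverse of \<open>n\<close> in \<open>R\<close> solves it.\<close>

lemma (in graded_algebra) power_sym_generators_mem:
  fixes a :: "nat \<Rightarrow> 'a"
  assumes p: "\<And>n. 1 \<le> n \<Longrightarrow>
      (\<Sum>d | d dvd n. const (of_nat d * a (n div d)) * w d ^ (n div d)) = power_sym n"
    and a: "\<And>k. a k \<in> R" "a 1 = 1"
    and inv: "\<And>n. 1 \<le> n \<Longrightarrow> \<exists>r\<in>R. r * of_nat n = 1"
    and mem: "\<And>n. 1 \<le> n \<Longrightarrow> power_sym n \<in> V n"
  shows "1 \<le> n \<Longrightarrow> w n \<in> V n"
proof (induction n rule: less_induct)
  case (less n)
  let ?s = "\<Sum>d | d dvd n \<and> d < n. const (of_nat d * a (n div d)) * w d ^ (n div d)"
  obtain r where r: "r \<in> R" "r * of_nat n = 1" using inv[OF less.prems] by auto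
  have "power_sym n = const (of_nat n) * w n + ?s"
    using p[OF less.prems] less.prems a(2) by (simp add: sum_divisors_top)
  then have "const r * (power_sym n - ?s) = const (r * of_nat n) * w n"
    by (simp add: const_mult mult.assoc)
  then have "w n = const r * (power_sym n - ?s)" using r(2) by simp
  moreover have "?s \<in> V n"
    using less a(1) by (intro sum_proper_divisors_mem) (auto intro: R_mult R_of_nat)
  ultimately show ?case using r(1) mem[OF less.prems] by (auto intro: V_const V_diff)
qed

lemma (in graded_algebra) power_sym_mem:
  assumes p: "(\<Sum>d | d dvd n. const (of_nat d * a (n div d)) * w d ^ (n div d)) = power_sym n"
    and a: "\<And>k. a k \<in> R" and w: "\<And>n. 1 \<le> n \<Longrightarrow> w n \<in> V n" and n: "1 \<le> n"
  shows "power_sym n \<in> V n"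
proof -
  have "const (of_nat n * a (n div n)) * w n ^ (n div n) \<in> V n"
    using V_power[OF w[OF n], of "n div n"] n by (intro V_const R_mult R_of_nat a) simp
  moreover have "(\<Sum>d | d dvd n \<and> d < n. const (of_nat d * a (n div d)) * w d ^ (n div d)) \<in> V n"
    using w n by (intro sum_proper_divisors_mem R_mult R_of_nat a)
  ultimately show ?thesis unfolding p[symmetric] sum_divisors_top[OF n] by (rule V_add)
qed

lemma (in graded_algebra) compl_sym_mem:
  assumes inv: "\<And>n. 1 \<le> n \<Longrightarrow> \<exists>r\<in>R. r * of_nat n = 1"
    and mem: "\<And>n. 1 \<le> n \<Longrightarrow> power_sym n \<in> V n"
  shows "compl_sym n \<in> V n"
proof (induction n rule: less_induct)
  case (less n)
  show ?case
  proof (cases "n = 0")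
    case True then show ?thesis by (simp add: compl_sym_0 V_1)
  next
    case False
    then obtain r where r: "r \<in> R" "r * of_nat n = 1" using inv[of n] by auto
    have "power_sym k * compl_sym (n - k) \<in> V n" if "k \<in> {1..n}" for k
      using V_mult[OF mem[of k] less[of "n - k"]] that by simp
    then have "of_nat n * compl_sym n \<in> V n" unfolding newton_identity by (rule V_sum)
    from V_const[OF r(1) this] show ?thesis
      using r(2) by (simp flip: mult.assoc const_mult const_of_nat)
  qed
qed

lemma power_sum_generators:
  fixes b :: "nat \<Rightarrow> 'a::field sf"
  assumes "coeff_ring R"
    and p: "\<And>n. 1 \<le> n \<Longrightarrow>
      (\<Sum>d | d dvd n. const (of_nat d * a (n div d)) * of_sf (b d) ^ (n div d)) = power_sym n"
    and a: "\<And>k. a k \<in> R" "a 1 = 1"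
    and inv: "\<And>n. 1 \<le> n \<Longrightarrow> \<exists>r\<in>R. r * of_nat n = 1"
  shows "\<And>n. 1 \<le> n \<Longrightarrow> of_sf (b n) \<in> sym_hom R n"
    and "\<And>n. elem_sym n \<in> part_span R (\<lambda>n. of_sf (b n)) n"
proof -
  interpret coeff_ring R by fact
  interpret S: graded_algebra R "sym_hom R" by (rule graded_algebra_sym_hom)
  interpret P: graded_algebra R "part_span R (\<lambda>n. of_sf (b n))" by (rule graded_algebra_part_span)
  show "of_sf (b n) \<in> sym_hom R n" if "1 \<le> n" for n
    using p a inv power_sym_sym_hom that by (rule S.power_sym_generators_mem)
  have "power_sym n \<in> part_span R (\<lambda>n. of_sf (b n)) n" if "1 \<le> n" for n
    by (rule P.power_sym_mem[OF p[OF that] a(1) _ that]) (rule part_span_gen)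
  with inv show "elem_sym n \<in> part_span R (\<lambda>n. of_sf (b n)) n" for n
    by (intro P.elem_sym_mem P.compl_sym_mem)
qed

text \<open>One identity is read in two directions: solved for the generator of index
  \<open>n\<close>, with \<open>r\<close> as the inverse of \<open>1 - q\<close>, it gives symmetry
  over \<open>R\<close>; read as a formula for \<open>compl_sym n\<close>, it puts the complete and
  hence the elementary functions into the span.\<close>

lemma factorization_generators:
  fixes b :: "nat \<Rightarrow> 'a::field_char_0 sf"
  assumes "coeff_ring R"
    and p: "\<And>n. 1 \<le> n \<Longrightarrow>
      (\<Sum>d | d dvd n. const (of_nat d * (1 - q ^ (n div d))) * of_sf (b d) ^ (n div d)) = power_sym n"
    and q: "q \<in> R" "r \<in> R" "r * (1 - q) = 1"
  shows "\<And>n. 1 \<le> n \<Longrightarrow> of_sf (b n) \<in> sym_hom R n"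
    and "\<And>n. elem_sym n \<in> part_span R (\<lambda>n. of_sf (b n)) n"
proof -
  interpret coeff_ring R by fact
  interpret S: graded_algebra R "sym_hom R" by (rule graded_algebra_sym_hom)
  interpret P: graded_algebra R "part_span R (\<lambda>n. of_sf (b n))" by (rule graded_algebra_part_span)
  let ?w = "\<lambda>n. of_sf (b n)"
  \<comment> \<open>Cutting the product exactly at \<open>n\<close> lets
    \<open>fac_prod_leading\<close> isolate the generator of index \<open>n\<close>.\<close>
  have compl: "compl_sym n = fac_prod (const q) ?w n $ n" for n
  proof (rule fac_prod_eq_compl_sym[symmetric])
    show "(\<Sum>d | d dvd k. of_nat d * (1 - const q ^ (k div d)) * ?w d ^ (k div d)) = power_sym k"
      if "1 \<le> k" for k
      using p[OF that] by (simp add: const_mult const_diff const_power const_of_nat)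
  qed simp
  show "?w n \<in> sym_hom R n" if "1 \<le> n" for n
    using that
  proof (induction n rule: less_induct)
    case (less n)
    have "(1 - const q) * ?w n = compl_sym n - fac_prod (const q) ?w (n - 1) $ n"
      using fac_prod_leading[OF less.prems, of "const q" ?w] compl[of n] by simp
    then have "const (r * (1 - q)) * ?w n
        = const r * (compl_sym n - fac_prod (const q) ?w (n - 1) $ n)"
      by (simp add: const_mult const_diff mult.assoc)
    then have "?w n = const r * (compl_sym n - fac_prod (const q) ?w (n - 1) $ n)"
      by (simp add: q(3))
    moreover have "fac_prod (const q) ?w (n - 1) $ n \<in> sym_hom R n"
      using less q(1) by (intro S.fac_prod_mem) auto
    ultimately show ?case using q(2) compl_sym_sym_hom by (simp add: S.V_const S.V_diff)
  qed
  have "compl_sym n \<in> part_span R ?w n" for n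
    unfolding compl using q(1) part_span_gen by (rule P.fac_prod_mem)
  then show "elem_sym n \<in> part_span R ?w n" for n by (rule P.elem_sym_mem)
qed

text \<open>The sum over partitions is the coefficient of t^n in the product of the series 1 / (1 -
  w_k t^k). Its only term involving \<open>w n\<close> is \<open>w n\<close> itself, with
  coefficient 1, so the change of generators inverts over any \<open>R\<close>.\<close>

lemma partition_sum_generators:
  fixes w h :: "nat \<Rightarrow> 'a::comm_ring_1 series"
  assumes "coeff_ring R"
    and h: "\<And>n. 1 \<le> n \<Longrightarrow> h n = (\<Sum>lam\<in>partitions n. part_prod w lam)"
    and w: "\<And>n. 1 \<le> n \<Longrightarrow> w n \<in> sym_hom R n" "\<And>n. elem_sym n \<in> part_span R w n"
  shows "\<And>n. 1 \<le> n \<Longrightarrow> h n \<in> sym_hom R n"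
    and "\<And>n. elem_sym n \<in> part_span R h n"
proof -
  interpret coeff_ring R by fact
  interpret S: graded_algebra R "sym_hom R" by (rule graded_algebra_sym_hom)
  interpret W: graded_algebra R "part_span R w" by (rule graded_algebra_part_span)
  interpret H: graded_algebra R "part_span R h" by (rule graded_algebra_part_span)
  have "h n \<in> part_span R w n" if "1 \<le> n" for n
    unfolding h[OF that] by (intro W.V_sum part_span_part_prod)
  then show "h n \<in> sym_hom R n" if "1 \<le> n" for n
    using S.part_span_subset[of w n] w(1) that by blast
  have "w n \<in> part_span R h n" if "1 \<le> n" for n
    using that
  proof (induction n rule: less_induct)
    case (less n)
    let ?s = "\<Sum>lam\<in>partitions n - {{#n#}}. part_prod w lam"
    have "{#n#} \<in> partitions n" using less.prems by (auto simp: partitions_def Par_def)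
    then have "h n = w n + ?s"
      using h[OF less.prems] by (simp add: sum.remove part_prod_def)
    moreover have "part_prod w lam \<in> part_span R h n" if "lam \<in> partitions n - {{#n#}}" for lam
    proof -
      have "part_prod w lam \<in> part_span R h (sum_mset lam)"
        using that partitions_part_less[of lam n] by (intro H.V_part_prod less.IH) auto
      with that show ?thesis by (simp add: partitions_def)
    qed
    then have "?s \<in> part_span R h n" by (rule H.V_sum)
    ultimately show ?case using H.V_diff[OF part_span_gen[OF less.prems, of h], of ?s] by simp
  qed
  from H.part_span_subset[OF this] w(2) show "elem_sym n \<in> part_span R h n" for n by blast
qed

section \<open>The two coefficient rings\<close>

lemma one_minus_qvar: "1 - qvar = Fract [:1, -1:] 1"
  by (simp add: qvar_def One_fract_def one_pCons)

lemma one_minus_qvar_neq_0: "1 - qvar \<noteq> 0"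
  by (simp add: one_minus_qvar Zero_fract_def eq_fract)

lemma coeff_ring_Qq: "coeff_ring Qq"
proof
  show "0 \<in> Qq" "1 \<in> Qq" by (auto simp: Qq_def Zero_fract_def One_fract_def)
qed (auto simp: Qq_def)

lemma Qq_inverse_of_nat:
  assumes "1 \<le> n"
  shows "\<exists>r\<in>Qq. r * of_nat n = 1"
proof -
  have "Fract [:inverse (of_nat n):] 1 * of_nat n = (1 :: ratfun)"
    using assms by (simp add: of_nat_fract of_nat_poly One_fract_def one_pCons)
  then show ?thesis by (force simp: Qq_def)
qed

lemma qint_Qq: "qint k \<in> Qq"
proof -
  interpret coeff_ring Qq by (rule coeff_ring_Qq)
  have "qvar \<in> Qq" by (auto simp: Qq_def qvar_def)
  then show ?thesis unfolding qint_def by (intro R_sum R_power)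
qed

lemma Zq_locI: "Fract (map_poly of_int P) 1 / (1 - qvar) ^ k \<in> Zq_loc"
  by (auto simp: Zq_loc_def)

lemma coeff_ring_Zq_loc: "coeff_ring Zq_loc"
proof
  let ?E = "\<lambda>P :: int poly. Fract (map_poly of_int P) 1 :: ratfun"
  have E_add: "?E (P + Q) = ?E P + ?E Q" for P Q 
    by (simp add: poly_eq_iff coeff_map_poly eq_fract)
  have E_mult: "?E (P * Q) = ?E P * ?E Q" for P Q 
    by (simp add: poly_eq_iff coeff_map_poly eq_fract coeff_mult)
  \<comment> \<open>\<open>[:1, -1:]\<close> is 1 - q as an integer polynomial; its powers bring two
    fractions to a common denominator.\<close>
  have E_q: "?E ([:1, -1:] ^ k) = (1 - qvar) ^ k" for k
  proof (induction k)
    case (Suc k)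
    have "?E [:1, -1:] = 1 - qvar" by (simp add: one_minus_qvar map_poly_pCons)
    with Suc show ?case by (simp only: power_Suc E_mult)
  qed (simp add: One_fract_def)
  show "0 \<in> Zq_loc" "1 \<in> Zq_loc"
    using Zq_locI[of 0 0] Zq_locI[of 1 0] by (auto simp flip: Zero_fract_def One_fract_def)
  fix a b assume "a \<in> Zq_loc" "b \<in> Zq_loc"
  then obtain P Q k l where a: "a = ?E P / (1 - qvar) ^ k" and b: "b = ?E Q / (1 - qvar) ^ l"
    by (auto simp: Zq_loc_def)
  have "a + b = ?E (P * [:1, -1:] ^ l + Q * [:1, -1:] ^ k) / (1 - qvar) ^ (k + l)"
    unfolding E_add E_mult E_q a b using one_minus_qvar_neq_0 by (simp add: field_simps power_add)
  then show "a + b \<in> Zq_loc" using Zq_locI by simp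
  have "a * b = ?E (P * Q) / (1 - qvar) ^ (k + l)"
    unfolding E_mult a b by (simp add: power_add)
  then show "a * b \<in> Zq_loc" using Zq_locI by simp
  have "- a = ?E (- P) / (1 - qvar) ^ k"
  proof -
    have "map_poly of_int (- P) = - (map_poly of_int P :: rat poly)"
      by (simp add: poly_eq_iff coeff_map_poly)
    then show ?thesis unfolding a by (simp flip: minus_fract)
  qed
  then show "- a \<in> Zq_loc" using Zq_locI by simp
qed

lemma qvar_Zq_loc: "qvar \<in> Zq_loc"
  using Zq_locI[of "[:0, 1:]" 0] by (simp add: qvar_def map_poly_pCons)

lemma inverse_one_minus_qvar_Zq_loc: "1 / (1 - qvar) \<in> Zq_loc"
  using Zq_locI[of 1 1] by (simp flip: One_fract_def)

theorem theorem4p5: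
  fixes u v h g :: "nat \<Rightarrow> ratfun sf"
  assumes u_def: "\<And>n. n \<ge> 1 \<Longrightarrow>
      sf_sum (\<lambda>d. sf_smult (of_nat d * qint (n div d)) (sf_pow (u d) (n div d))) {d. d dvd n}
        = psum n"
    and v_def: "\<And>n. n \<ge> 1 \<Longrightarrow>
      sf_sum (\<lambda>d. sf_smult (of_nat d * (1 - qvar ^ (n div d))) (sf_pow (v d) (n div d))) {d. d dvd n}
        = psum n"
    and h_def: "\<And>n. n \<ge> 1 \<Longrightarrow>
      h n = sf_sum (\<lambda>\<mu>. sf_part u \<mu>) {\<mu>. \<mu> \<in> Par \<and> sum_mset \<mu> = n}"
    and g_def: "\<And>n. n \<ge> 1 \<Longrightarrow>
      g n = sf_sum (\<lambda>\<mu>. sf_part v \<mu>) {\<mu>. \<mu> \<in> Par \<and> sum_mset \<mu> = n}"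
  shows "is_sf_basis Qq (sf_part u) \<and> is_sf_basis Qq (sf_part h) \<and>
         is_sf_basis Zq_loc (sf_part v) \<and> is_sf_basis Zq_loc (sf_part g)"
proof -
  have pu: "(\<Sum>d | d dvd n. const (of_nat d * qint (n div d)) * of_sf (u d) ^ (n div d)) = power_sym n"
    if "1 \<le> n" for n
    using arg_cong[OF u_def[OF that], of of_sf]
    by (simp only: of_sf_sum of_sf_smult of_sf_pow of_sf_psum)
  have pv: "(\<Sum>d | d dvd n. const (of_nat d * (1 - qvar ^ (n div d))) * of_sf (v d) ^ (n div d))
      = power_sym n" if "1 \<le> n" for n
    using arg_cong[OF v_def[OF that], of of_sf]
    by (simp only: of_sf_sum of_sf_smult of_sf_pow of_sf_psum)
  have h: "of_sf (h n) = (\<Sum>lam\<in>partitions n. part_prod (\<lambda>n. of_sf (u n)) lam)" if "1 \<le> n" for n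
    unfolding h_def[OF that] of_sf_sum of_sf_part partitions_def ..
  have g: "of_sf (g n) = (\<Sum>lam\<in>partitions n. part_prod (\<lambda>n. of_sf (v n)) lam)" if "1 \<le> n" for n
    unfolding g_def[OF that] of_sf_sum of_sf_part partitions_def ..
  have q1: "1 / (1 - qvar) * (1 - qvar) = 1" using one_minus_qvar_neq_0 by simp
  have qint1: "qint 1 = 1" by (simp add: qint_def)
  note u = power_sum_generators[OF coeff_ring_Qq pu qint_Qq qint1 Qq_inverse_of_nat]
  note v = factorization_generators[OF coeff_ring_Zq_loc pv qvar_Zq_loc
      inverse_one_minus_qvar_Zq_loc q1]
  note h' = partition_sum_generators[OF coeff_ring_Qq h u]
  note g' = partition_sum_generators[OF coeff_ring_Zq_loc g v]
  from is_sf_basisI[OF coeff_ring_Qq u] is_sf_basisI[OF coeff_ring_Qq h']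
    is_sf_basisI[OF coeff_ring_Zq_loc v] is_sf_basisI[OF coeff_ring_Zq_loc g']
  show ?thesis by blast
qed

end
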